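(* Assume that $T$ is a uniquely ergodic homeomorphism of a compact metric space $X$, with unique invariant probability measure $\mu$. Assume moreover that $(X,\mu,T)$ has the AOP property. Then, for each multiplicative function $\boldsymbol u:\mathbb N\to\mathbb C$, $|\boldsymbol u|\le1$, for each $k\ge1$ and $0\le j<k$, we have $$\frac1N\sum_{n\le N}f(T^nx)\boldsymbol u(kn+j)\to0$$ as $N\to\infty$ for each $f\in C(X)$ of zero mean and each $x\in X$. In particular, $$\frac1N\sum_{n\le N}f(T^nx)\boldsymbol\mu(kn+j)\to0,$$ where $\boldsymbol\mu$ is the Möbius function.
   Context: $\boldsymbol u$ is multiplicative if $\boldsymbol u(mn)=\boldsymbol u(m)\boldsymbol u(n)$ whenever $\gcd(m,n)=1$. Zero mean is with respect to $\mu$. For automorphisms $T,S$ of $(X,\mathcal B,\mu)$, $(Y,\mathcal C,\nu)$, $J^e(T,S)$ denotes the set of ergodic joinings: $T\times S$-invariant and ergodic probability measures on $X\times Y$ with marginals $\mu$ and $\nu$. A totally ergodic automorphism $T$ of $(X,\mathcal B,\mu)$ (all non-zero powers ergodic) has the AOP property if for all zero mean $f,g\in L^2(X,\mu)$ $$\limsup_{p,q\to\infty,\ p\ne q\text{ primes}}\ \sup_{\rho\in J^e(T^p,T^q)}\left|\int_{X\times X}f\otimes g\,d\rho\right|=0 .$$ *)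

theory Defs
  imports "HOL-Probability.Probability" "HOL-Computational_Algebra.Squarefree"
begin

definition measure_preserving :: "'a measure \<Rightarrow> ('a \<Rightarrow> 'a) \<Rightarrow> bool" where
  "measure_preserving M T \<longleftrightarrow> T \<in> measurable M M \<and> distr M M T = M"

definition automorphism :: "'a measure \<Rightarrow> ('a \<Rightarrow> 'a) \<Rightarrow> bool" where
  "automorphism M T \<longleftrightarrow> prob_space M \<and> measure_preserving M T \<and>
     bij_betw T (space M) (space M) \<and> inv_into (space M) T \<in> measurable M M"

definition ergodic :: "'a measure \<Rightarrow> ('a \<Rightarrow> 'a) \<Rightarrow> bool" where
  "ergodic M T \<longleftrightarrow> prob_space M \<and> measure_preserving M T \<and>
     (\<forall>A\<in>sets M. T -` A \<inter> space M = A \<longrightarrow> measure M A = 0 \<or> measure M A = 1)"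

definition totally_ergodic :: "'a measure \<Rightarrow> ('a \<Rightarrow> 'a) \<Rightarrow> bool" where
  "totally_ergodic M T \<longleftrightarrow> automorphism M T \<and>
     (\<forall>n>0. ergodic M (T ^^ n) \<and> ergodic M (inv_into (space M) T ^^ n))"

definition joinings :: "'a measure \<Rightarrow> ('a \<Rightarrow> 'a) \<Rightarrow> 'b measure \<Rightarrow> ('b \<Rightarrow> 'b) \<Rightarrow> ('a \<times> 'b) measure set" where
  "joinings M T N S = {\<rho>. prob_space \<rho> \<and> sets \<rho> = sets (M \<Otimes>\<^sub>M N) \<and>
     distr \<rho> M fst = M \<and> distr \<rho> N snd = N \<and> measure_preserving \<rho> (map_prod T S)}"

definition ergodic_joinings :: "'a measure \<Rightarrow> ('a \<Rightarrow> 'a) \<Rightarrow> 'b measure \<Rightarrow> ('b \<Rightarrow> 'b) \<Rightarrow> ('a \<times> 'b) measure set" where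
  "ergodic_joinings M T N S = {\<rho> \<in> joinings M T N S. ergodic \<rho> (map_prod T S)}"

text \<open>Square-integrable functions rather than classes modulo null sets: every expression below in
  which they occur is unchanged when they are modified on a null set.\<close>

definition zero_mean_L2 :: "'a measure \<Rightarrow> ('a \<Rightarrow> complex) set" where
  "zero_mean_L2 M = {f \<in> borel_measurable M.
     integrable M (\<lambda>x. (norm (f x))\<^sup>2) \<and> integral\<^sup>L M f = 0}"

definition distinct_primes_at_top :: "(nat \<times> nat) filter" where
  "distinct_primes_at_top =
     inf (at_top \<times>\<^sub>F at_top) (principal {(p, q). prime p \<and> prime q \<and> p \<noteq> q})"

text \<open>The supremum and the limit superior are taken in \<^typ>\<open>ennreal\<close>, where they always exist and
  the supremum of the empty set is 0.\<close>

definition AOP :: "'a measure \<Rightarrow> ('a \<Rightarrow> 'a) \<Rightarrow> bool" where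
  "AOP M T \<longleftrightarrow> totally_ergodic M T \<and>
     (\<forall>f\<in>zero_mean_L2 M. \<forall>g\<in>zero_mean_L2 M.
        Limsup distinct_primes_at_top
          (\<lambda>(p, q). SUP \<rho>\<in>ergodic_joinings M (T ^^ p) M (T ^^ q).
             ennreal (norm (\<integral>z. f (fst z) * g (snd z) \<partial>\<rho>))) = 0)"

definition invariant_borel_prob :: "('a::topological_space \<Rightarrow> 'a) \<Rightarrow> 'a measure \<Rightarrow> bool" where
  "invariant_borel_prob T M \<longleftrightarrow> prob_space M \<and> sets M = sets borel \<and> measure_preserving M T"

definition uniquely_ergodic :: "('a::topological_space \<Rightarrow> 'a) \<Rightarrow> 'a measure \<Rightarrow> bool" where
  "uniquely_ergodic T M \<longleftrightarrow>
     invariant_borel_prob T M \<and> (\<forall>N. invariant_borel_prob T N \<longrightarrow> N = M)"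

text \<open>Arithmetic functions live on the positive integers; their value at 0 is irrelevant.\<close>

definition multiplicative :: "(nat \<Rightarrow> complex) \<Rightarrow> bool" where
  "multiplicative u \<longleftrightarrow> (\<forall>m>0. \<forall>n>0. coprime m n \<longrightarrow> u (m * n) = u m * u n)"

definition moebius_mu :: "nat \<Rightarrow> int" where
  "moebius_mu n = (if squarefree n then (-1) ^ card (prime_factors n) else 0)"

end

theory Submission
  imports Defs
begin

text \<open>
  Let $a(m) = f(T^{(m-j)/k}x)$ for $m \<equiv> j$ modulo $k$, and $a(m) = 0$ otherwise. The
  averages of $f(T^n x)\,u(kn+j)$ are, up to a bounded factor and a vanishing error, averages of
  $a(m)u(m)$. By the criterion of Katai, Bourgain, Sarnak and Ziegler
  (\<open>katai_bourgain_sarnak_ziegler\<close>) these tend to 0 for every multiplicative $u$ bounded by 1, provided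
  that $\frac1n \<Sum>_{m\<le>n} a(pm)\overline{a(qm)}$ is asymptotically small for large primes $p \<noteq> q$. Sorted by the
  residue of $m$ modulo $k$, such a correlation becomes a sum of at most $k$ correlations of
  $f(T^{pl}y)$ and $f(T^{ql}z)$, $l = 0, 1, \<dots>$, that is, of orbit sums of $f \<otimes> \bar f$ under
  $T^p \<times> T^q$ (\<open>orbit_on_progression_correlations\<close>).

  Any weak limit of the empirical measures of such an orbit is invariant under $T^p \<times> T^q$. Its marginals are
  invariant under $T^p$ and $T^q$, and since $T$ is uniquely ergodic and all its powers are ergodic, these
  powers are uniquely ergodic too (\<open>power_uniquely_ergodic\<close>), so that the limit is a joining. The AOP
  property bounds the integral of $f \<otimes> \bar f$ for ergodic joinings; it extends to all joinings because a
  continuous affine functional on the compact convex set of invariant measures is almost maximised at an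
  extreme point, and extreme points are ergodic (\<open>exists_almost_maximal_ergodic_measure\<close>). Together this is
  \<open>AOP_orbit_correlations\<close>.

  The weak compactness that is used twice here is obtained from Helly's theorem on the real line: a
  compact metric space has a Borel encoding by real numbers whose inverse is uniformly continuous
  (\<open>borel_prob_sequentially_compact\<close>).

  The criterion itself compares $\<Sum> a(n)u(n)$ with $\<Sum> a(n)u(n)\<omega>(n)$, where $\<omega>(n)$ counts the prime divisors of $n$
  from a finite set $P$ of large primes. By the Turan-Kubilius inequality $\<omega>$ is on average close to
  $A = \<Sum>_{p\<in>P} 1/p$, which can be made large since this series diverges. The weighted sum is a bilinear
  sum over $p$ and $m = n/p$, to which the Cauchy-Schwarz inequality and the correlation bounds apply
  in each dyadic block of primes separately. The blocks matter: the correlations of one pair $p, q$ need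
  not vanish in the limit, they are only small when $p$ and $q$ are large, and without the blocks the
  loss would grow with the size of the primes.
\<close>

section \<open>Compact metric spaces\<close>

text \<open>The balls of radius $1/m$ around the points of a finite $1/m$-net, for all $m$, in one sequence.
  Stating the covering property with a bound $N$ on the index is what makes the encoding below
  uniformly continuous backwards, and the base property of the $A_n$ follows from it.\<close>

lemma compact_metric_countable_base:
  assumes "compact (UNIV :: 'b::metric_space set)"
  obtains A :: "nat \<Rightarrow> 'b::metric_space set"
  where "\<And>n. open (A n)"
    and "\<And>e. e > 0 \<Longrightarrow> \<exists>N. \<forall>x. \<exists>n<N. x \<in> A n \<and> (\<forall>y\<in>A n. dist x y < e)"
proof -
  have "\<forall>m. \<exists>k. finite k \<and> (UNIV :: 'b set) \<subseteq> (\<Union>x\<in>k. ball x (1 / real (Suc m)))"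
    using assms unfolding compact_eq_totally_bounded by simp
  then obtain k where k: "\<And>m. finite (k m)"
      "\<And>m. (UNIV :: 'b set) \<subseteq> (\<Union>x\<in>k m. ball x (1 / real (Suc m)))"
    by metis
  define C where "C = (\<Union>m. (\<lambda>x. ball x (1 / real (Suc m))) ` k m)"
  have ne: "C \<noteq> {}" using k(2)[of 0] UNIV_I[of undefined] unfolding C_def by blast
  have cC: "countable C" unfolding C_def using k(1) by (auto intro: countable_finite)
  have rng: "range (from_nat_into C) = C" using range_from_nat_into[OF ne cC] .
  show ?thesis
  proof (rule that[of "from_nat_into C"])
    show "open (from_nat_into C n)" for n
      using from_nat_into[OF ne, of n] by (auto simp: C_def)
    fix e :: real assume "e > 0"
    then obtain m where m: "1 / real (Suc m) < e / 2"
      using nat_approx_posE[of "e/2"] by auto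
    define F where "F = (\<lambda>x. ball x (1 / real (Suc m))) ` k m"
    have F: "finite F" "F \<subseteq> C" using k(1) by (auto simp: F_def C_def)
    then obtain I where I: "finite I" "from_nat_into C ` I = F"
      by (metis rng finite_subset_image subset_UNIV)
    obtain N where N: "\<forall>i\<in>I. i < N" using I(1) finite_nat_set_iff_bounded by blast
    have "\<exists>n<N. x \<in> from_nat_into C n \<and> (\<forall>y\<in>from_nat_into C n. dist x y < e)" for x
    proof -
      obtain a where a: "a \<in> k m" "x \<in> ball a (1 / real (Suc m))" using k(2)[of m] by blast
      then obtain i where i: "i \<in> I" "from_nat_into C i = ball a (1 / real (Suc m))"
        using I(2) unfolding F_def by (metis (no_types, lifting) imageE imageI)
      have "dist x y < e" if "y \<in> ball a (1 / real (Suc m))" for y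
      proof -
        have "dist x y \<le> dist a x + dist a y" by (metis dist_commute dist_triangle)
        then show ?thesis using that a(2) m by simp
      qed
      then show ?thesis using N i a(2) by metis
    qed
    then show "\<exists>N. \<forall>x. \<exists>n<N. x \<in> from_nat_into C n \<and> (\<forall>y\<in>from_nat_into C n. dist x y < e)"
      by blast
  qed
qed

text \<open>At the first index $i$ where the digits differ, the two numbers differ by $3^{-i}$ up to the tail
  $\<Sum>_{l>i} 3^{-l} = 3^{-i}/2$: base 3 with digits 0 and 1 leaves gaps, unlike base 2.\<close>

lemma ternary_digits_agree:
  fixes P Q :: "nat \<Rightarrow> bool"
  assumes "\<bar>(\<Sum>n. of_bool (P n) * (1/3)^n) - (\<Sum>n. of_bool (Q n) * (1/3)^n)\<bar> < (1/3 :: real)^N / 2"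
    and "n \<le> N"
  shows "P n = Q n"
proof (rule ccontr)
  assume "P n \<noteq> Q n"
  define i where "i = (LEAST i. P i \<noteq> Q i)"
  have i: "P i \<noteq> Q i" "i \<le> n"
    unfolding i_def using LeastI[of "\<lambda>i. P i \<noteq> Q i", OF \<open>P n \<noteq> Q n\<close>]
      Least_le[of "\<lambda>i. P i \<noteq> Q i", OF \<open>P n \<noteq> Q n\<close>] by blast+
  have below: "P l = Q l" if "l < i" for l using that not_less_Least unfolding i_def by blast
  define D where "D l = (of_bool (P l) - of_bool (Q l)) * (1/3 :: real)^l" for l
  have geo: "summable (\<lambda>n. (1/3 :: real)^n)" by (simp add: summable_geometric)
  have sR: "summable (\<lambda>n. of_bool (R n) * (1/3 :: real)^n)" for R
    by (rule summable_comparison_test'[OF geo, of 0]) auto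
  have sD: "summable D"
    unfolding D_def left_diff_distrib by (intro summable_diff sR)
  have suminf_D: "suminf D = (\<Sum>n. of_bool (P n) * (1/3)^n) - (\<Sum>n. of_bool (Q n) * (1/3)^n)"
    unfolding D_def left_diff_distrib by (intro suminf_diff[symmetric] sR)
  have tail: "\<bar>\<Sum>l. D (l + Suc i)\<bar> \<le> (1/3)^i / 2"
  proof -
    have "summable (\<lambda>l. (1/3 :: real)^Suc i * (1/3)^l)" by (intro summable_mult geo)
    moreover have "norm (D (l + Suc i)) \<le> (1/3)^Suc i * (1/3)^l" for l
      by (auto simp: D_def power_add abs_mult)
    ultimately have "norm (\<Sum>l. D (l + Suc i)) \<le> (\<Sum>l. (1/3)^Suc i * (1/3)^l)"
      by (intro norm_suminf_le)
    also have "\<dots> = (1/3)^Suc i * (\<Sum>l. (1/3)^l)" by (rule suminf_mult[OF geo])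
    also have "\<dots> = (1/3)^i / 2" by (simp add: suminf_geometric)
    finally show ?thesis by simp
  qed
  have "suminf D = (\<Sum>l. D (l + Suc i)) + sum D {..<Suc i}"
    by (rule suminf_split_initial_segment[OF sD])
  also have "sum D {..<Suc i} = D i" using below by (simp add: D_def)
  finally have "\<bar>D i\<bar> \<le> \<bar>suminf D\<bar> + (1/3)^i / 2" using tail by linarith
  moreover have "\<bar>D i\<bar> = (1/3)^i" using i(1) by (auto simp: D_def)
  ultimately have "(1/3)^i / 2 \<le> \<bar>suminf D\<bar>" by simp
  moreover have "(1/3 :: real)^N \<le> (1/3)^i" using i(2) assms(2) by (intro power_decreasing) auto
  ultimately show False using assms(1) suminf_D by simp
qed

text \<open>The digits of \<open>s y\<close> in base 3 record which members of the base contain \<open>y\<close>. The map \<open>s\<close> is only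
  Borel, but points with close codes share the membership in a small ball, so they are close. This
  transports weak limits from the real line, where Helly's theorem is at hand, to any compact metric
  space.\<close>

lemma compact_metric_encoding:
  assumes "compact (UNIV :: 'b::metric_space set)"
  obtains s :: "'b::metric_space \<Rightarrow> real"
  where "s \<in> borel_measurable borel" "\<And>y. 0 \<le> s y \<and> s y \<le> 2"
    and "\<And>e. e > 0 \<Longrightarrow> \<exists>d>0. \<forall>y y'. \<bar>s y - s y'\<bar> < d \<longrightarrow> dist y y' < e"
proof -
  obtain A :: "nat \<Rightarrow> 'b set" where A: "\<And>n. open (A n)"
    "\<And>e. e > 0 \<Longrightarrow> \<exists>N. \<forall>x. \<exists>n<N. x \<in> A n \<and> (\<forall>y\<in>A n. dist x y < e)"
    using compact_metric_countable_base[OF assms] by blast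
  define s where "s y = (\<Sum>n. of_bool (y \<in> A n) * (1/3 :: real)^n)" for y
  have geo: "summable (\<lambda>n. (1/3 :: real)^n)" by (simp add: summable_geometric)
  have sR: "summable (\<lambda>n. of_bool (y \<in> A n) * (1/3 :: real)^n)" for y
    by (rule summable_comparison_test'[OF geo, of 0]) auto
  show ?thesis
  proof (rule that[of s])
    have "(\<lambda>y. of_bool (y \<in> A n)) \<in> borel_measurable borel" for n
      unfolding of_bool_def using A(1)[of n] by (intro measurable_If) auto
    then show "s \<in> borel_measurable borel" unfolding s_def
      by (intro borel_measurable_suminf borel_measurable_times) auto
    show "0 \<le> s y \<and> s y \<le> 2" for y
    proof -
      have "s y \<le> (\<Sum>n. (1/3)^n)" unfolding s_def by (rule suminf_le[OF _ sR geo]) auto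
      also have "\<dots> \<le> 2" by (simp add: suminf_geometric)
      finally show ?thesis unfolding s_def using suminf_nonneg[OF sR] by auto
    qed
    fix e :: real assume "e > 0"
    then obtain N where N: "\<forall>x. \<exists>n<N. x \<in> A n \<and> (\<forall>y\<in>A n. dist x y < e)" using A(2) by blast
    have "dist y y' < e" if d: "\<bar>s y - s y'\<bar> < (1/3)^N / 2" for y y'
    proof -
      obtain n where n: "n < N" "y \<in> A n" "\<forall>z\<in>A n. dist y z < e" using N by blast
      then have "y' \<in> A n"
        using ternary_digits_agree[of "\<lambda>n. y \<in> A n" "\<lambda>n. y' \<in> A n" N n] d
        unfolding s_def by auto
      then show ?thesis using n by blast
    qed
    then show "\<exists>d>0. \<forall>y y'. \<bar>s y - s y'\<bar> < d \<longrightarrow> dist y y' < e"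
      by (intro exI[of _ "(1/3)^N / 2"]) auto
  qed
qed

text \<open>A point of the closure of the codes is a limit of codes whose arguments form a Cauchy sequence;
  compactness supplies the limit of the arguments. The auxiliary relation \<open>near\<close> is the sequence-free
  form of ``\<open>y\<close> is the limit of the points whose codes tend to \<open>x\<close>''.\<close>

lemma encoding_decoder:
  fixes s :: "'b::metric_space \<Rightarrow> real"
  assumes "compact (UNIV :: 'b set)"
    and unif: "\<And>e. e > 0 \<Longrightarrow> \<exists>d>0. \<forall>y y'. \<bar>s y - s y'\<bar> < d \<longrightarrow> dist y y' < e"
  obtains \<pi> where "continuous_on (closure (range s)) \<pi>" "\<And>y. \<pi> (s y) = y"
proof -
  define near where "near x y \<longleftrightarrow> (\<forall>e>0. \<exists>d>0. \<forall>u. \<bar>s u - x\<bar> < d \<longrightarrow> dist u y < e)" for x y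
  have ex: "\<exists>y. near x y" if x: "x \<in> closure (range s)" for x
  proof -
    obtain v where v: "\<forall>n. v n \<in> range s" "v \<longlonglongrightarrow> x"
      using x by (auto simp: closure_sequential)
    have "\<forall>n. \<exists>y. v n = s y" using v(1) by blast
    then obtain u where u: "\<And>n. v n = s (u n)" by metis
    obtain y r where r: "strict_mono r" "(u \<circ> r) \<longlonglongrightarrow> y"
      using seq_compactE[OF compact_imp_seq_compact[OF assms(1)], of u] by (metis UNIV_I)
    have sx: "(\<lambda>n. s (u (r n))) \<longlonglongrightarrow> x"
      using LIMSEQ_subseq_LIMSEQ[OF v(2) r(1)] by (simp add: u o_def)
    have "near x y" unfolding near_def
    proof (intro allI impI)
      fix e :: real assume "e > 0"
      then obtain d where d: "d > 0" "\<forall>y y'. \<bar>s y - s y'\<bar> < d \<longrightarrow> dist y y' < e / 2"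
        using unif[of "e/2"] by auto
      have "\<forall>\<^sub>F n in sequentially. \<bar>s (u (r n)) - x\<bar> < d / 2"
        using tendstoD[OF sx, of "d/2"] d(1) by (simp add: dist_real_def)
      moreover have "\<forall>\<^sub>F n in sequentially. dist (u (r n)) y < e / 2"
        using tendstoD[OF r(2), of "e/2"] \<open>e > 0\<close> by simp
      ultimately obtain n where n: "\<bar>s (u (r n)) - x\<bar> < d / 2" "dist (u (r n)) y < e / 2"
        using eventually_happens'[OF _ eventually_conj] by (metis (no_types, lifting) sequentially_bot)
      have "dist w y < e" if "\<bar>s w - x\<bar> < d / 2" for w
      proof -
        have "\<bar>s w - s (u (r n))\<bar> < d" using that n(1) by linarith
        then have "dist w (u (r n)) < e / 2" using d(2) by blast
        then show ?thesis using n(2) dist_triangle[of w y "u (r n)"] by linarith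
      qed
      then show "\<exists>d>0. \<forall>u. \<bar>s u - x\<bar> < d \<longrightarrow> dist u y < e"
        using d(1) by (intro exI[of _ "d/2"]) auto
    qed
    then show ?thesis by blast
  qed
  define \<pi> where "\<pi> x = (SOME y. near x y)" for x
  have near: "near x (\<pi> x)" if "x \<in> closure (range s)" for x
    unfolding \<pi>_def using ex[OF that] by (rule someI_ex)
  show ?thesis
  proof (rule that[of \<pi>])
    show "\<pi> (s y) = y" for y
    proof -
      have "s y \<in> closure (range s)" using closure_subset[of "range s"] by auto
      then have "near (s y) (\<pi> (s y))" by (rule near)
      then have *: "\<forall>e>0. \<exists>d>0. \<forall>u. \<bar>s u - s y\<bar> < d \<longrightarrow> dist u (\<pi> (s y)) < e"
        unfolding near_def .
      have "dist y (\<pi> (s y)) < e" if e: "e > 0" for e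
        using *[rule_format, OF e] by auto
      then show ?thesis by (metis dist_pos_lt less_irrefl)
    qed
    show "continuous_on (closure (range s)) \<pi>"
      unfolding continuous_on_iff
    proof (intro ballI allI impI)
      fix x e :: real assume x: "x \<in> closure (range s)" and "e > 0"
      then obtain d where d: "d > 0" "\<forall>u. \<bar>s u - x\<bar> < d \<longrightarrow> dist u (\<pi> x) < e / 2"
        using near[OF x] unfolding near_def by (metis half_gt_zero)
      have "dist (\<pi> x') (\<pi> x) < e" if x': "x' \<in> closure (range s)" "dist x' x < d / 2" for x'
      proof -
        obtain d' where d': "d' > 0" "\<forall>u. \<bar>s u - x'\<bar> < d' \<longrightarrow> dist u (\<pi> x') < e / 2"
          using near[OF x'(1)] \<open>e > 0\<close> unfolding near_def by (metis half_gt_zero)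
        obtain u where u: "dist (s u) x' < min d' (d/2)"
          using x'(1) d(1) d'(1) unfolding closure_approachable
          by (metis (no_types, lifting) half_gt_zero image_iff min_less_iff_conj)
        then have "dist u (\<pi> x') < e / 2" using d'(2) by (simp add: dist_real_def)
        moreover have "\<bar>s u - x\<bar> < d" using u x'(2) unfolding dist_real_def by linarith
        then have "dist u (\<pi> x) < e / 2" using d(2) by blast
        ultimately show ?thesis using dist_triangle3[of "\<pi> x'" "\<pi> x" u] by linarith
      qed
      then show "\<exists>d>0. \<forall>x'\<in>closure (range s). dist x' x < d \<longrightarrow> dist (\<pi> x') (\<pi> x) < e"
        using d(1) by (intro exI[of _ "d/2"]) auto
    qed
  qed
qed

text \<open>The type of points carries no countable base by its class, so the countable base of open rectangles
  comes from compactness.\<close>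

lemma sets_borel_pair_compact_metric:
  assumes "compact (UNIV :: 'a::metric_space set)"
  shows "sets (borel \<Otimes>\<^sub>M borel :: ('a \<times> 'a) measure) = sets borel"
proof
  obtain A :: "nat \<Rightarrow> 'a set" where A: "\<And>n. open (A n)"
    "\<And>e. e > 0 \<Longrightarrow> \<exists>N. \<forall>x. \<exists>n<N. x \<in> A n \<and> (\<forall>y\<in>A n. dist x y < e)"
    using compact_metric_countable_base[OF assms] by blast
  have base: "\<exists>n. x \<in> A n \<and> A n \<subseteq> U" if U: "open U" "x \<in> U" for x U
  proof -
    obtain e where "e > 0" "\<And>y. dist x y < e \<Longrightarrow> y \<in> U"
      using U by (metis dist_commute open_dist)
    then show ?thesis using A(2)[of e] by (meson subsetI)
  qed
  have "U \<in> sets (borel \<Otimes>\<^sub>M borel)" if U: "open U" for U :: "('a \<times> 'a) set"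
  proof -
    define I where "I = {(i, j). A i \<times> A j \<subseteq> U}"
    have "U = (\<Union>(i, j)\<in>I. A i \<times> A j)"
    proof
      show "U \<subseteq> (\<Union>(i, j)\<in>I. A i \<times> A j)"
      proof
        fix z assume "z \<in> U"
        then obtain V W where VW: "open V" "open W" "z \<in> V \<times> W" "V \<times> W \<subseteq> U"
          using open_prod_elim[OF U] by metis
        then obtain i j where "fst z \<in> A i" "A i \<subseteq> V" "snd z \<in> A j" "A j \<subseteq> W"
          using base[of V "fst z"] base[of W "snd z"] by (auto simp: mem_Times_iff)
        then show "z \<in> (\<Union>(i, j)\<in>I. A i \<times> A j)"
          using VW(4) by (intro UN_I[of "(i, j)"]) (auto simp: mem_Times_iff I_def)
      qed
    qed (auto simp: I_def)
    also have "\<dots> \<in> sets (borel \<Otimes>\<^sub>M borel)"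
      using A(1) by (intro sets.countable_UN'') (auto intro!: pair_measureI)
    finally show ?thesis .
  qed
  then show "sets (borel :: ('a \<times> 'a) measure) \<subseteq> sets (borel \<Otimes>\<^sub>M borel)"
    using sets.sigma_sets_subset[of "{U. open U}" "borel \<Otimes>\<^sub>M borel :: ('a \<times> 'a) measure"]
    by (auto simp: sets_borel space_pair_measure)
next
  have "fst \<in> borel \<rightarrow>\<^sub>M (borel :: 'a measure)" "snd \<in> borel \<rightarrow>\<^sub>M (borel :: 'a measure)"
    by (auto intro!: borel_measurable_continuous_onI continuous_intros)
  then have "(\<lambda>z. (fst z, snd z)) \<in> borel \<rightarrow>\<^sub>M (borel \<Otimes>\<^sub>M borel :: ('a \<times> 'a) measure)"
    by (rule measurable_Pair)
  then have id: "(\<lambda>z. z) \<in> borel \<rightarrow>\<^sub>M (borel \<Otimes>\<^sub>M borel :: ('a \<times> 'a) measure)" by simp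
  show "sets (borel \<Otimes>\<^sub>M borel :: ('a \<times> 'a) measure) \<subseteq> sets borel"
    using measurable_sets[OF id] by (auto simp: space_pair_measure)
qed

section \<open>Borel probability measures on a compact metric space\<close>

definition borel_prob :: "'b::topological_space measure \<Rightarrow> bool" where
  "borel_prob \<mu> \<longleftrightarrow> prob_space \<mu> \<and> sets \<mu> = sets borel"

lemma borel_prob_measurable:
  "borel_prob \<mu> \<Longrightarrow> f \<in> borel \<rightarrow>\<^sub>M N \<Longrightarrow> f \<in> \<mu> \<rightarrow>\<^sub>M N"
  by (simp add: borel_prob_def cong: measurable_cong_sets)

lemma borel_prob_space: "borel_prob \<mu> \<Longrightarrow> space \<mu> = UNIV"
  unfolding borel_prob_def using sets_eq_imp_space_eq[of \<mu> borel] by simp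

lemma borel_prob_distr:
  assumes "borel_prob \<mu>" "f \<in> borel \<rightarrow>\<^sub>M borel"
  shows "borel_prob (distr \<mu> borel f)"
  using assms borel_prob_measurable[OF assms]
  by (simp add: borel_prob_def prob_space.prob_space_distr)

lemma compact_UNIV_bounded:
  fixes h :: "'b::topological_space \<Rightarrow> 'c::real_normed_vector"
  assumes "compact (UNIV :: 'b set)" "continuous_on UNIV h"
  obtains B where "B > 0" "\<And>x. norm (h x) \<le> B"
proof -
  have "bounded (range h)" using assms by (intro compact_imp_bounded compact_continuous_image)
  then show ?thesis using that unfolding bounded_pos by auto
qed

lemma integrable_bounded_borel_prob:
  fixes h :: "'b::topological_space \<Rightarrow> 'c::{banach, second_countable_topology}"
  assumes "borel_prob \<mu>" "h \<in> borel_measurable borel" "\<And>x. norm (h x) \<le> B"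
  shows "integrable \<mu> h"
proof -
  interpret prob_space \<mu> using assms(1) by (simp add: borel_prob_def)
  show ?thesis
    using assms(3) borel_prob_measurable[OF assms(1,2)] by (intro integrable_const_bound[of _ B]) auto
qed

lemma integrable_continuous_borel_prob:
  fixes h :: "'b::topological_space \<Rightarrow> 'c::{banach, second_countable_topology}"
  assumes "compact (UNIV :: 'b set)" "borel_prob \<mu>" "continuous_on UNIV h"
  shows "integrable \<mu> h"
proof -
  obtain B where "\<And>x. norm (h x) \<le> B" using compact_UNIV_bounded[OF assms(1,3)] by auto
  then show ?thesis
    by (rule integrable_bounded_borel_prob[OF assms(2) borel_measurable_continuous_onI[OF assms(3)]])
qed

lemma integral_le_borel_prob:
  fixes h :: "'b::topological_space \<Rightarrow> real"
  assumes "borel_prob \<mu>" "integrable \<mu> h" "\<And>x. h x \<le> c"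
  shows "integral\<^sup>L \<mu> h \<le> c"
proof -
  interpret prob_space \<mu> using assms(1) by (simp add: borel_prob_def)
  show ?thesis using assms by (intro integral_le_const) auto
qed

lemma integral_distr_borel_prob:
  fixes h :: "'b::topological_space \<Rightarrow> 'c::{banach, second_countable_topology}"
  assumes "borel_prob \<mu>" "S \<in> borel \<rightarrow>\<^sub>M borel" "h \<in> borel_measurable borel"
  shows "integral\<^sup>L (distr \<mu> borel S) h = (\<integral>y. h (S y) \<partial>\<mu>)"
  by (rule integral_distr[OF borel_prob_measurable[OF assms(1,2)] assms(3)])

definition converges_weakly :: "(nat \<Rightarrow> 'b::topological_space measure) \<Rightarrow> 'b measure \<Rightarrow> bool" where
  "converges_weakly \<mu> \<rho> \<longleftrightarrow>
     (\<forall>h :: 'b \<Rightarrow> real. continuous_on UNIV h \<longrightarrow> (\<lambda>n. integral\<^sup>L (\<mu> n) h) \<longlonglongrightarrow> integral\<^sup>L \<rho> h)"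

text \<open>Push the measures to the real line by the encoding. They live on a bounded interval, hence are tight,
  and Helly's theorem gives a weak limit there. The limit is carried by the closed set $K$ of limits of
  codes, since the continuous function $\min(1, d(\cdot, K))$ has integral zero along the sequence.
  The decoder $\<pi>$ pulls it back; a continuous $h$ on the compact space is tested through a continuous
  extension (Tietze) of $h \<circ> \<pi>$ from $K$ to the line.\<close>

theorem borel_prob_sequentially_compact:
  fixes \<mu> :: "nat \<Rightarrow> 'b::metric_space measure"
  assumes comp: "compact (UNIV :: 'b set)" and \<mu>: "\<And>n. borel_prob (\<mu> n)"
  obtains r \<rho> where "strict_mono (r :: nat \<Rightarrow> nat)" "borel_prob \<rho>"
    "converges_weakly (\<lambda>n. \<mu> (r n)) \<rho>"
proof -
  obtain s :: "'b \<Rightarrow> real" where s: "s \<in> borel_measurable borel" "\<And>y. 0 \<le> s y \<and> s y \<le> 2"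
    "\<And>e. e > 0 \<Longrightarrow> \<exists>d>0. \<forall>y y'. \<bar>s y - s y'\<bar> < d \<longrightarrow> dist y y' < e"
    using compact_metric_encoding[OF comp] by blast
  obtain \<pi> where \<pi>: "continuous_on (closure (range s)) \<pi>" "\<And>y. \<pi> (s y) = y"
    using encoding_decoder[OF comp s(3)] by blast
  define K where "K = closure (range s)"
  have sK: "s y \<in> K" for y unfolding K_def using closure_subset[of "range s"] by auto
  have Kne: "K \<noteq> {}" using sK by auto
  have clK: "closed K" by (simp add: K_def)
  define \<nu> where "\<nu> n = distr (\<mu> n) borel s" for n
  have \<nu>: "real_distribution (\<nu> n)" for n
    using borel_prob_distr[OF \<mu> s(1), of n]
    by (simp add: \<nu>_def borel_prob_def real_distribution_def real_distribution_axioms_def)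
  have "tight \<nu>"
    unfolding tight_def
  proof (intro conjI allI impI)
    fix e :: real assume "e > 0"
    have "measure (\<nu> n) {-1<..2} = 1" for n
    proof -
      have "s -` {-1<..2} = UNIV" using s(2) by (force intro: order.strict_trans2[of "-1" 0])
      then show ?thesis
        using borel_prob_measurable[OF \<mu> s(1)] \<mu>[of n] borel_prob_space[OF \<mu>, of n]
        by (simp add: \<nu>_def measure_distr borel_prob_def prob_space.prob_space[of "\<mu> n", simplified])
          (metis prob_space.prob_space)
    qed
    then show "\<exists>a b. a < b \<and> (\<forall>n. 1 - e < measure (\<nu> n) {a<..b})"
      using \<open>e > 0\<close> by (intro exI[of _ "-1"] exI[of _ 2]) auto
  qed (rule \<nu>)
  then obtain r N where r: "strict_mono (r :: nat \<Rightarrow> nat)" and N: "real_distribution N"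
    and conv: "weak_conv_m (\<nu> \<circ> r) N"
    using tight_imp_convergent_subsubsequence[of \<nu> id] by (auto simp: strict_mono_def)
  interpret N: real_distribution N by (rule N)
  have N': "borel_prob N" using N by (simp add: borel_prob_def real_distribution_def N.events_eq_borel)
  have lim: "(\<lambda>n. integral\<^sup>L (\<nu> (r n)) G) \<longlonglongrightarrow> integral\<^sup>L N G"
    if "continuous_on UNIV G" "\<And>x. norm (G x) \<le> B" for G :: "real \<Rightarrow> real" and B
    using weak_conv_imp_integral_bdd_continuous_conv[OF _ N conv, of G B] \<nu> that
    by (simp add: continuous_on_eq_continuous_at)
  have int\<nu>: "integral\<^sup>L (\<nu> n) G = (\<integral>y. G (s y) \<partial>\<mu> n)" if "continuous_on UNIV G"
    for G :: "real \<Rightarrow> real" and n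
    unfolding \<nu>_def
    by (intro integral_distr_borel_prob \<mu> s(1) borel_measurable_continuous_onI that)
  have "AE x in N. x \<in> K"
  proof -
    define G where "G x = min 1 (infdist x K)" for x
    have G: "continuous_on UNIV G" "\<And>x. 0 \<le> G x" "\<And>x. norm (G x) \<le> 1"
      unfolding G_def by (auto intro!: continuous_intros simp: infdist_nonneg)
    have "(\<lambda>n. integral\<^sup>L (\<nu> (r n)) G) = (\<lambda>n. 0)"
      using sK by (simp add: int\<nu>[OF G(1)] G_def)
    then have "integral\<^sup>L N G = 0"
      using lim[OF G(1,3)] by (simp add: LIMSEQ_const_iff)
    moreover have "integrable N G"
      by (rule integrable_bounded_borel_prob[OF N' borel_measurable_continuous_onI[OF G(1)] G(3)])
    ultimately have "AE x in N. G x = 0"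
      using G(2) by (simp add: integral_nonneg_eq_0_iff_AE)
    then show ?thesis
    proof eventually_elim
      case (elim x)
      then show ?case
        using in_closed_iff_infdist_zero[OF clK Kne, of x] by (simp add: G_def min_def split: if_splits)
    qed
  qed
  define \<pi>' where "\<pi>' x = (if x \<in> K then \<pi> x else undefined)" for x
  have m\<pi>': "\<pi>' \<in> borel \<rightarrow>\<^sub>M borel"
    unfolding \<pi>'_def using clK \<pi>(1) by (intro borel_measurable_continuous_on_if) (auto simp: K_def)
  define \<rho> where "\<rho> = distr N borel \<pi>'"
  show ?thesis
  proof (rule that[OF r, of \<rho>])
    show "borel_prob \<rho>" unfolding \<rho>_def by (rule borel_prob_distr[OF N' m\<pi>'])
    show "converges_weakly (\<lambda>n. \<mu> (r n)) \<rho>"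
      unfolding converges_weakly_def
    proof (intro allI impI)
      fix h :: "'b \<Rightarrow> real" assume h: "continuous_on UNIV h"
      obtain B where B: "B > 0" "\<And>x. norm (h x) \<le> B" using compact_UNIV_bounded[OF comp h] by blast
      have "continuous_on K (\<lambda>x. h (\<pi> x))"
        using continuous_on_compose2[OF h \<pi>(1)] by (simp add: K_def)
      then obtain G where G: "continuous_on UNIV G" "\<And>x. x \<in> K \<Longrightarrow> G x = h (\<pi> x)"
        "\<And>x. norm (G x) \<le> B"
        using Tietze[of K "\<lambda>x. h (\<pi> x)" UNIV B] clK B by auto
      have "integral\<^sup>L \<rho> h = (\<integral>x. h (\<pi>' x) \<partial>N)"
        unfolding \<rho>_def using h by (intro integral_distr_borel_prob N' m\<pi>' borel_measurable_continuous_onI)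
      also have "\<dots> = integral\<^sup>L N G"
      proof (rule integral_cong_AE)
        show "(\<lambda>x. h (\<pi>' x)) \<in> borel_measurable N"
          using measurable_comp[OF m\<pi>' borel_measurable_continuous_onI[OF h]] by (simp add: o_def)
        show "G \<in> borel_measurable N" using borel_measurable_continuous_onI[OF G(1)] by simp
        show "AE x in N. h (\<pi>' x) = G x"
          using \<open>AE x in N. x \<in> K\<close> by eventually_elim (simp add: \<pi>'_def G(2))
      qed
      finally show "(\<lambda>n. integral\<^sup>L (\<mu> (r n)) h) \<longlonglongrightarrow> integral\<^sup>L \<rho> h"
        using lim[OF G(1,3)] sK by (simp add: int\<nu>[OF G(1)] G(2) \<pi>(2))
    qed
  qed
qed

text \<open>The indicator of each finite intersection of base sets is an increasing limit of continuous functions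
  with values in $[0,1]$, and these intersections form a countable intersection-stable generator of the
  Borel sets.\<close>

lemma countable_determining_family:
  assumes comp: "compact (UNIV :: 'b::metric_space set)"
  obtains h :: "nat \<Rightarrow> 'b::metric_space \<Rightarrow> real"
  where "\<And>i. continuous_on UNIV (h i)" "\<And>i y. 0 \<le> h i y \<and> h i y \<le> 1"
    and "\<forall>\<mu> \<nu>. borel_prob \<mu> \<and> borel_prob \<nu> \<and>
           (\<forall>i. integral\<^sup>L \<mu> (h i) = integral\<^sup>L \<nu> (h i)) \<longrightarrow> \<mu> = \<nu>"
proof -
  obtain A :: "nat \<Rightarrow> 'b set" where A: "\<And>n. open (A n)"
    "\<And>e. e > 0 \<Longrightarrow> \<exists>N. \<forall>x. \<exists>n<N. x \<in> A n \<and> (\<forall>y\<in>A n. dist x y < e)"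
    using compact_metric_countable_base[OF comp] by blast
  define U where "U F = (\<Inter>n\<in>set F. A n)" for F
  have oU: "open (U F)" for F unfolding U_def using A(1) by auto
  have "topological_basis (range U)"
  proof (rule topological_basisI)
    fix V :: "'b set" and x assume V: "open V" "x \<in> V"
    then obtain e where e: "e > 0" "\<And>y. dist x y < e \<Longrightarrow> y \<in> V"
      by (metis dist_commute open_dist)
    then obtain n where "x \<in> A n" "\<forall>y\<in>A n. dist x y < e" using A(2)[of e] by metis
    then show "\<exists>B\<in>range U. x \<in> B \<and> B \<subseteq> V"
      using e(2) by (intro bexI[OF _ rangeI[of U "[n]"]]) (auto simp: U_def)
  qed (use oU in auto)
  then have "borel = sigma UNIV (range U)" by (intro borel_eq_countable_basis) auto
  then have sU: "sets borel = sigma_sets UNIV (range U)" by (metis sets_measure_of top_greatest Pow_UNIV)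
  define g where "g F m y = (if U F = UNIV then 1 else min 1 (real m * infdist y (- U F)))"
    for F and m :: nat and y
  have g: "continuous_on UNIV (g F m)" "0 \<le> g F m y" "g F m y \<le> 1" for F m y
    unfolding g_def by (cases "U F = UNIV"; auto intro!: continuous_intros simp: infdist_nonneg)+
  have g_lim: "(\<lambda>m. g F m y) \<longlonglongrightarrow> indicator (U F) y" for F y
  proof (cases "U F = UNIV \<or> y \<notin> U F")
    case True
    then show ?thesis by (cases "U F = UNIV"; auto simp: g_def indicator_def)
  next
    case False
    then have pos: "infdist y (- U F) > 0"
      using oU[of F] by (intro infdist_pos_not_in_closed) auto
    obtain m0 where m0: "1 / infdist y (- U F) < real m0" using reals_Archimedean2 by blast
    have "g F m y = 1" if "m \<ge> m0" for m
    proof -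
      have "1 / infdist y (- U F) < real m" using m0 that by linarith
      then show ?thesis using False pos by (simp add: g_def field_simps)
    qed
    then show ?thesis
      using False by (intro tendsto_eventually) (auto simp: eventually_sequentially)
  qed
  define h where "h i = (case from_nat i of (F, m) \<Rightarrow> g F m)" for i
  have hg: "h (to_nat (F, m)) = g F m" for F m by (simp add: h_def)
  show ?thesis
  proof (rule that[of h], safe)
    show "continuous_on UNIV (h i)" "0 \<le> h i y" "h i y \<le> 1" for i y
      using g by (auto simp: h_def split: prod.split)
    fix \<mu> \<nu> :: "'b measure"
    assume \<mu>: "borel_prob \<mu>" and \<nu>: "borel_prob \<nu>"
      and eq: "\<forall>i. integral\<^sup>L \<mu> (h i) = integral\<^sup>L \<nu> (h i)"
    have lim: "(\<lambda>m. integral\<^sup>L \<kappa> (g F m)) \<longlonglongrightarrow> measure \<kappa> (U F)" if \<kappa>: "borel_prob \<kappa>" for \<kappa> F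
    proof -
      interpret prob_space \<kappa> using \<kappa> by (simp add: borel_prob_def)
      have "(\<lambda>m. integral\<^sup>L \<kappa> (g F m)) \<longlonglongrightarrow> (\<integral>y. indicator (U F) y \<partial>\<kappa>)"
      proof (rule integral_dominated_convergence[where w="\<lambda>_. 1"])
        show "indicator (U F) \<in> borel_measurable \<kappa>"
          by (rule borel_prob_measurable[OF \<kappa>]) (use oU in auto)
        show "g F m \<in> borel_measurable \<kappa>" for m
          by (rule borel_prob_measurable[OF \<kappa> borel_measurable_continuous_onI[OF g(1)]])
      qed (use g g_lim in auto)
      then show ?thesis using \<kappa> by (simp add: borel_prob_space)
    qed
    show "\<mu> = \<nu>"
    proof (rule measure_eqI_generator_eq[of "range U" UNIV _ _ "\<lambda>_. UNIV"])
      show "Int_stable (range U)"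
      proof (rule Int_stableI, clarify)
        fix F G
        have "U F \<inter> U G = U (F @ G)" by (auto simp: U_def)
        then show "U F \<inter> U G \<in> range U" by auto
      qed
      show "emeasure \<mu> X = emeasure \<nu> X" if "X \<in> range U" for X
      proof -
        obtain F where X: "X = U F" using \<open>X \<in> range U\<close> by auto
        have "integral\<^sup>L \<mu> (g F m) = integral\<^sup>L \<nu> (g F m)" for m
          using eq[rule_format, of "to_nat (F, m)"] by (simp only: hg)
        then have "measure \<mu> (U F) = measure \<nu> (U F)"
          using LIMSEQ_unique[OF lim[OF \<mu>, of F]] lim[OF \<nu>, of F] by simp
        then show ?thesis using \<mu> \<nu>
          by (simp add: X borel_prob_def finite_measure.emeasure_eq_measure prob_space.finite_measure)
      qed
      show "sets \<mu> = sigma_sets UNIV (range U)" "sets \<nu> = sigma_sets UNIV (range U)"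
        using \<mu> \<nu> sU by (auto simp: borel_prob_def)
      have "U [] = UNIV" by (simp add: U_def)
      then show "range (\<lambda>_. UNIV) \<subseteq> range U" by auto
      show "emeasure \<mu> UNIV \<noteq> \<infinity>"
        using \<mu> by (simp add: borel_prob_def finite_measure.emeasure_finite prob_space.finite_measure)
    qed auto
  qed
qed

lemma borel_prob_eqI:
  assumes comp: "compact (UNIV :: 'b::metric_space set)" and "borel_prob \<mu>" "borel_prob \<nu>"
    and "\<And>h :: 'b \<Rightarrow> real. continuous_on UNIV h \<Longrightarrow> integral\<^sup>L \<mu> h = integral\<^sup>L \<nu> h"
  shows "\<mu> = \<nu>"
proof -
  obtain h :: "nat \<Rightarrow> 'b \<Rightarrow> real" where "\<And>i. continuous_on UNIV (h i)"
    and "\<forall>\<mu> \<nu>. borel_prob \<mu> \<and> borel_prob \<nu> \<and>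
           (\<forall>i. integral\<^sup>L \<mu> (h i) = integral\<^sup>L \<nu> (h i)) \<longrightarrow> \<mu> = \<nu>"
    by (rule countable_determining_family[OF comp]) (rule that)
  then show ?thesis using assms by auto
qed

section \<open>Invariant and ergodic measures of a continuous map\<close>

lemma invariant_borel_prob_iff:
  "invariant_borel_prob S \<rho> \<longleftrightarrow> borel_prob \<rho> \<and> measure_preserving \<rho> S"
  by (auto simp: invariant_borel_prob_def borel_prob_def)

lemma invariant_borel_prob_iff_distr:
  assumes "borel_prob \<rho>" "S \<in> borel \<rightarrow>\<^sub>M borel"
  shows "invariant_borel_prob S \<rho> \<longleftrightarrow> distr \<rho> borel S = \<rho>"
proof -
  have s: "sets \<rho> = sets borel" using assms(1) by (simp add: borel_prob_def)
  have "S \<in> \<rho> \<rightarrow>\<^sub>M \<rho>"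
    using assms(2) by (simp add: s cong: measurable_cong_sets)
  moreover have "distr \<rho> \<rho> S = distr \<rho> borel S" by (rule distr_cong) (auto simp: s)
  ultimately show ?thesis
    using assms(1) by (simp add: invariant_borel_prob_iff measure_preserving_def)
qed

lemma invariant_integral:
  fixes h :: "'b::topological_space \<Rightarrow> 'c::{banach, second_countable_topology}"
  assumes "invariant_borel_prob S \<rho>" "S \<in> borel \<rightarrow>\<^sub>M borel" "h \<in> borel_measurable borel"
  shows "(\<integral>y. h (S y) \<partial>\<rho>) = integral\<^sup>L \<rho> h"
proof -
  have \<rho>: "borel_prob \<rho>" using assms(1) by (simp add: invariant_borel_prob_iff)
  have "distr \<rho> borel S = \<rho>" using invariant_borel_prob_iff_distr[OF \<rho> assms(2)] assms(1) by simp
  then show ?thesis using integral_distr_borel_prob[OF \<rho> assms(2,3)] by simp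
qed

text \<open>Asymptotic invariance suffices, so that the lemma serves both for sequences of invariant measures and
  for the empirical measures of an orbit.\<close>

lemma invariant_limit_measure:
  fixes S :: "'b::metric_space \<Rightarrow> 'b"
  assumes comp: "compact (UNIV :: 'b set)" and S: "continuous_on UNIV S"
    and \<mu>: "\<And>n. borel_prob (\<mu> n)"
    and inv: "\<forall>h :: 'b \<Rightarrow> real. continuous_on UNIV h \<longrightarrow>
                (\<lambda>n. (\<integral>y. h (S y) \<partial>\<mu> n) - integral\<^sup>L (\<mu> n) h) \<longlonglongrightarrow> 0"
  obtains r \<rho> where "strict_mono (r :: nat \<Rightarrow> nat)" "invariant_borel_prob S \<rho>"
    "converges_weakly (\<lambda>n. \<mu> (r n)) \<rho>"
proof -
  obtain r \<rho> where r: "strict_mono (r :: nat \<Rightarrow> nat)" and \<rho>: "borel_prob \<rho>"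
    and lim: "converges_weakly (\<lambda>n. \<mu> (r n)) \<rho>"
    by (rule borel_prob_sequentially_compact[OF comp \<mu>]) (rule that)
  have mS: "S \<in> borel \<rightarrow>\<^sub>M borel" by (rule borel_measurable_continuous_onI[OF S])
  have "distr \<rho> borel S = \<rho>"
  proof (rule borel_prob_eqI[OF comp borel_prob_distr[OF \<rho> mS] \<rho>])
    fix h :: "'b \<Rightarrow> real" assume h: "continuous_on UNIV h"
    have "continuous_on UNIV (\<lambda>y. h (S y))"
      using continuous_on_compose2[OF h S] by simp
    then have "(\<lambda>n. (\<integral>y. h (S y) \<partial>\<mu> (r n)) - integral\<^sup>L (\<mu> (r n)) h)
        \<longlonglongrightarrow> (\<integral>y. h (S y) \<partial>\<rho>) - integral\<^sup>L \<rho> h"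
      by (intro tendsto_diff lim[unfolded converges_weakly_def, rule_format] h)
    moreover have "(\<lambda>n. (\<integral>y. h (S y) \<partial>\<mu> (r n)) - integral\<^sup>L (\<mu> (r n)) h) \<longlonglongrightarrow> 0"
      using LIMSEQ_subseq_LIMSEQ[OF inv[rule_format, OF h] r] by (simp add: o_def)
    ultimately have "(\<integral>y. h (S y) \<partial>\<rho>) = integral\<^sup>L \<rho> h"
      using LIMSEQ_unique by fastforce
    then show "integral\<^sup>L (distr \<rho> borel S) h = integral\<^sup>L \<rho> h"
      using integral_distr_borel_prob[OF \<rho> mS borel_measurable_continuous_onI[OF h]] by simp
  qed
  then have "invariant_borel_prob S \<rho>"
    using invariant_borel_prob_iff_distr[OF \<rho> mS] by simp
  then show ?thesis using r lim by (intro that)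
qed

lemma invariant_uniform_measure:
  assumes \<rho>: "invariant_borel_prob S \<rho>" and A: "A \<in> sets \<rho>" "S -` A \<inter> space \<rho> = A"
    and pos: "measure \<rho> A > 0"
  shows "invariant_borel_prob S (uniform_measure \<rho> A)"
proof -
  have bp: "borel_prob \<rho>" and S: "S \<in> \<rho> \<rightarrow>\<^sub>M \<rho>" "distr \<rho> \<rho> S = \<rho>"
    using \<rho> by (auto simp: invariant_borel_prob_iff measure_preserving_def)
  have sp: "space \<rho> = UNIV" using borel_prob_space[OF bp] .
  interpret prob_space \<rho> using bp by (simp add: borel_prob_def)
  have ne: "emeasure \<rho> A \<noteq> 0" "emeasure \<rho> A \<noteq> \<infinity>"
    using pos by (auto simp: emeasure_eq_measure)
  have "borel_prob (uniform_measure \<rho> A)"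
    using bp prob_space_uniform_measure[OF ne] by (simp add: borel_prob_def)
  moreover have mS: "S \<in> uniform_measure \<rho> A \<rightarrow>\<^sub>M uniform_measure \<rho> A"
    using S(1) by (simp cong: measurable_cong_sets)
  moreover have "distr (uniform_measure \<rho> A) (uniform_measure \<rho> A) S = uniform_measure \<rho> A"
  proof (rule measure_eqI)
    fix B assume "B \<in> sets (distr (uniform_measure \<rho> A) (uniform_measure \<rho> A) S)"
    then have B: "B \<in> sets \<rho>" by simp
    have SB: "S -` B \<in> sets \<rho>" using measurable_sets[OF S(1) B] by (simp add: sp)
    have "emeasure (distr (uniform_measure \<rho> A) (uniform_measure \<rho> A) S) B
        = emeasure \<rho> (A \<inter> S -` B) / emeasure \<rho> A"
      using emeasure_distr[OF mS, of B] B SB A(1) by (simp add: sp)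
    also have "A \<inter> S -` B = S -` (A \<inter> B) \<inter> space \<rho>" using A(2) by (auto simp: sp)
    also have "emeasure \<rho> (S -` (A \<inter> B) \<inter> space \<rho>) = emeasure \<rho> (A \<inter> B)"
      using emeasure_distr[OF S(1), of "A \<inter> B"] A(1) B by (simp add: S(2))
    finally show "emeasure (distr (uniform_measure \<rho> A) (uniform_measure \<rho> A) S) B
        = emeasure (uniform_measure \<rho> A) B"
      using A(1) B by simp
  qed simp
  ultimately show ?thesis by (simp add: invariant_borel_prob_iff measure_preserving_def)
qed

lemma (in prob_space) integral_uniform_measure:
  fixes h :: "'a \<Rightarrow> real"
  assumes A: "A \<in> sets M" "measure M A > 0" and h: "h \<in> borel_measurable M"
  shows "measure M A * integral\<^sup>L (uniform_measure M A) h = (\<integral>x. indicator A x * h x \<partial>M)"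
proof -
  have "uniform_measure M A = density M (\<lambda>x. ennreal (indicator A x / measure M A))"
    unfolding uniform_measure_def emeasure_eq_measure
    using A by (intro density_cong) (auto simp: indicator_def divide_ennreal ennreal_1[symmetric] simp del: ennreal_1)
  then have "integral\<^sup>L (uniform_measure M A) h = (\<integral>x. (indicator A x / measure M A) *\<^sub>R h x \<partial>M)"
    using A h by (simp only: , intro integral_density) auto
  also have "\<dots> = (\<integral>x. indicator A x * h x / measure M A \<partial>M)" by simp
  also have "\<dots> = (\<integral>x. indicator A x * h x \<partial>M) / measure M A" by (rule integral_divide_zero)
  finally show ?thesis using A by simp
qed

text \<open>The functional is weakly continuous and the invariant measures are weakly sequentially compact.\<close>

lemma exists_maximal_invariant_measure:
  fixes S :: "'b::metric_space \<Rightarrow> 'b" and \<Phi> :: "'b measure \<Rightarrow> real"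
  assumes comp: "compact (UNIV :: 'b set)" and S: "continuous_on UNIV S"
    and \<rho>0: "invariant_borel_prob S \<rho>0"
    and bdd: "\<And>\<rho>. invariant_borel_prob S \<rho> \<Longrightarrow> \<Phi> \<rho> \<le> B"
    and cont: "\<And>\<mu> \<rho>. \<lbrakk>\<And>n. borel_prob (\<mu> n); borel_prob \<rho>; converges_weakly \<mu> \<rho>\<rbrakk>
        \<Longrightarrow> (\<lambda>n. \<Phi> (\<mu> n)) \<longlonglongrightarrow> \<Phi> \<rho>"
  obtains \<rho> where "invariant_borel_prob S \<rho>" "\<And>\<rho>'. invariant_borel_prob S \<rho>' \<Longrightarrow> \<Phi> \<rho>' \<le> \<Phi> \<rho>"
proof -
  define I where "I = {\<rho>. invariant_borel_prob S \<rho>}"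
  have I: "I \<noteq> {}" "bdd_above (\<Phi> ` I)" using \<rho>0 bdd unfolding I_def by (auto intro!: bdd_aboveI2)
  define s where "s = (SUP \<rho>\<in>I. \<Phi> \<rho>)"
  have "\<exists>\<rho>\<in>I. s - 1 / real (Suc n) < \<Phi> \<rho>" for n
    unfolding s_def using less_cSUP_iff[OF I, of "(SUP \<rho>\<in>I. \<Phi> \<rho>) - 1 / real (Suc n)"] by simp
  then obtain \<mu> where \<mu>: "\<And>n. invariant_borel_prob S (\<mu> n)" "\<And>n. s - 1 / real (Suc n) < \<Phi> (\<mu> n)"
    unfolding I_def by (metis mem_Collect_eq)
  have bp: "borel_prob (\<mu> n)" for n using \<mu>(1) by (simp add: invariant_borel_prob_iff)
  have mS: "S \<in> borel \<rightarrow>\<^sub>M borel" by (rule borel_measurable_continuous_onI[OF S])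
  have "(\<lambda>n. (\<integral>y. h (S y) \<partial>\<mu> n) - integral\<^sup>L (\<mu> n) h) \<longlonglongrightarrow> 0" if "continuous_on UNIV h"
    for h :: "'b \<Rightarrow> real"
    using invariant_integral[OF \<mu>(1) mS borel_measurable_continuous_onI[OF that]] by simp
  then have asymp: "\<forall>h :: 'b \<Rightarrow> real. continuous_on UNIV h \<longrightarrow>
    (\<lambda>n. (\<integral>y. h (S y) \<partial>\<mu> n) - integral\<^sup>L (\<mu> n) h) \<longlonglongrightarrow> 0" by blast
  obtain r \<rho> where r: "strict_mono (r :: nat \<Rightarrow> nat)" and \<rho>: "invariant_borel_prob S \<rho>"
    and lim: "converges_weakly (\<lambda>n. \<mu> (r n)) \<rho>"
    by (rule invariant_limit_measure[OF comp S bp asymp]) (rule that)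
  have "borel_prob \<rho>" using \<rho> by (simp add: invariant_borel_prob_iff)
  then have conv: "(\<lambda>n. \<Phi> (\<mu> (r n))) \<longlonglongrightarrow> \<Phi> \<rho>" by (intro cont bp lim)
  have "(\<lambda>n. s - 1 / real (Suc n)) \<longlonglongrightarrow> s - 0"
    by (intro tendsto_intros LIMSEQ_inverse_real_of_nat[unfolded inverse_eq_divide])
  then have "(\<lambda>n. s - 1 / real (Suc (r n))) \<longlonglongrightarrow> s"
    using LIMSEQ_subseq_LIMSEQ[OF _ r] by (fastforce simp: o_def)
  then have "s \<le> \<Phi> \<rho>"
    by (rule LIMSEQ_le[OF _ conv]) (use \<mu>(2) in \<open>auto intro: less_imp_le\<close>)
  moreover have "\<Phi> \<rho>' \<le> s" if "invariant_borel_prob S \<rho>'" for \<rho>'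
    unfolding s_def by (rule cSUP_upper[OF _ I(2)]) (simp add: I_def that)
  ultimately show ?thesis using that[OF \<rho>] by (meson order_trans)
qed

text \<open>This replaces the ergodic decomposition. Maximise
  $\int \<phi>\,d\<rho> + \<delta> \<Sum>_i 2^{-i-1} (\int h_i\,d\<rho>)^2$
  over the invariant measures, where the $h_i$ determine the measure. The perturbation is at most
  $\<delta>$, so that the maximiser $\<rho>$ is almost optimal for $\<phi>$; it is strictly convex, so that
  $\<rho>$ is an extreme point: an invariant set of measure $t$ strictly between 0 and 1 would write $\<rho>$ as a
  convex combination of two invariant conditional measures, which by maximality have the same integrals
  of all $h_i$, although they are mutually singular.\<close>

theorem exists_almost_maximal_ergodic_measure:
  fixes S :: "'b::metric_space \<Rightarrow> 'b" and \<phi> :: "'b \<Rightarrow> real"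
  assumes comp: "compact (UNIV :: 'b set)" and S: "continuous_on UNIV S"
    and \<rho>0: "invariant_borel_prob S \<rho>0" and \<phi>: "continuous_on UNIV \<phi>" and "\<delta> > 0"
  obtains \<rho> where "invariant_borel_prob S \<rho>" "ergodic \<rho> S"
    "integral\<^sup>L \<rho> \<phi> \<ge> integral\<^sup>L \<rho>0 \<phi> - \<delta>"
proof -
  obtain h :: "nat \<Rightarrow> 'b \<Rightarrow> real" where h: "\<And>i. continuous_on UNIV (h i)"
      "\<And>i y. 0 \<le> h i y \<and> h i y \<le> 1"
    and det: "\<forall>\<mu> \<nu>. borel_prob \<mu> \<and> borel_prob \<nu> \<and>
           (\<forall>i. integral\<^sup>L \<mu> (h i) = integral\<^sup>L \<nu> (h i)) \<longrightarrow> \<mu> = \<nu>"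
    by (rule countable_determining_family[OF comp]) (rule that)
  define q where "q \<rho> i = (1/2)^Suc i * (integral\<^sup>L \<rho> (h i))\<^sup>2" for \<rho> i
  define \<Phi> where "\<Phi> \<rho> = integral\<^sup>L \<rho> \<phi> + \<delta> * suminf (q \<rho>)" for \<rho>
  have int: "integrable \<rho> g" if "borel_prob \<rho>" "continuous_on UNIV g" for \<rho> and g :: "'b \<Rightarrow> real"
    using integrable_continuous_borel_prob[OF comp that] .
  have h01: "0 \<le> integral\<^sup>L \<rho> (h i) \<and> integral\<^sup>L \<rho> (h i) \<le> 1" if "borel_prob \<rho>" for \<rho> i
    using integral_le_borel_prob[OF that int[OF that h(1)], of i 1] h(2)
    by (auto intro: integral_nonneg_AE)
  have geo: "(\<lambda>i. (1/2 :: real)^Suc i) sums 1" by (rule power_half_series)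
  have q: "0 \<le> q \<rho> i" "q \<rho> i \<le> (1/2)^Suc i" if "borel_prob \<rho>" for \<rho> i
    using h01[OF that, of i] by (auto simp: q_def power_le_one)
  have sq: "summable (q \<rho>)" if "borel_prob \<rho>" for \<rho>
    using q[OF that] by (intro summable_comparison_test'[OF sums_summable[OF geo], of 0]) auto
  have Q01: "0 \<le> suminf (q \<rho>)" "suminf (q \<rho>) \<le> 1" if "borel_prob \<rho>" for \<rho>
    using suminf_nonneg[OF sq[OF that] q(1)[OF that]]
      suminf_le[OF q(2)[OF that] sq[OF that] sums_summable[OF geo]] sums_unique[OF geo] by auto
  obtain B where B: "B > 0" "\<And>x. norm (\<phi> x) \<le> B" by (rule compact_UNIV_bounded[OF comp \<phi>]) (rule that)
  obtain \<rho> where \<rho>: "invariant_borel_prob S \<rho>"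
    and max: "\<And>\<rho>'. invariant_borel_prob S \<rho>' \<Longrightarrow> \<Phi> \<rho>' \<le> \<Phi> \<rho>"
  proof (rule exists_maximal_invariant_measure[OF comp S \<rho>0, of \<Phi> "B + \<delta>"])
    fix \<rho>' assume "invariant_borel_prob S \<rho>'"
    then have bp: "borel_prob \<rho>'" by (simp add: invariant_borel_prob_iff)
    have "integral\<^sup>L \<rho>' \<phi> \<le> B"
      using B(2) by (intro integral_le_borel_prob[OF bp int[OF bp \<phi>]]) (simp add: abs_le_iff)
    moreover have "\<delta> * suminf (q \<rho>') \<le> \<delta>" using Q01(2)[OF bp] \<open>\<delta> > 0\<close> by simp
    ultimately show "\<Phi> \<rho>' \<le> B + \<delta>" by (simp add: \<Phi>_def)
  next
    fix \<mu> :: "nat \<Rightarrow> 'b measure" and \<rho>'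
    assume \<mu>: "\<And>n. borel_prob (\<mu> n)" and \<rho>': "borel_prob \<rho>'"
      and lim: "converges_weakly \<mu> \<rho>'"
    have "(\<lambda>n. suminf (\<lambda>i. q (\<mu> n) i)) \<longlonglongrightarrow> suminf (q \<rho>')"
    proof (rule conjunct2[OF conjunct2[OF tannerys_theorem]])
      show "(\<lambda>n. q (\<mu> n) i) \<longlonglongrightarrow> q \<rho>' i" for i
        unfolding q_def by (intro tendsto_intros lim[unfolded converges_weakly_def, rule_format] h(1))
      show "\<forall>\<^sub>F (i, n) in at_top \<times>\<^sub>F sequentially. norm (q (\<mu> n) i) \<le> (1/2)^Suc i"
        using q[OF \<mu>] by (intro always_eventually) auto
    qed (use sums_summable[OF geo] in auto)
    then show "(\<lambda>n. \<Phi> (\<mu> n)) \<longlonglongrightarrow> \<Phi> \<rho>'"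
      unfolding \<Phi>_def by (intro tendsto_intros lim[unfolded converges_weakly_def, rule_format] \<phi>)
  qed (rule that)
  have bp: "borel_prob \<rho>" and S\<rho>: "measure_preserving \<rho> S"
    using \<rho> by (auto simp: invariant_borel_prob_iff)
  have sp: "space \<rho> = UNIV" using borel_prob_space[OF bp] .
  interpret prob_space \<rho> using bp by (simp add: borel_prob_def)
  have "measure \<rho> A = 0 \<or> measure \<rho> A = 1" if A: "A \<in> sets \<rho>" "S -` A \<inter> space \<rho> = A" for A
  proof (rule ccontr)
    assume "\<not> (measure \<rho> A = 0 \<or> measure \<rho> A = 1)"
    then have t: "0 < measure \<rho> A" "measure \<rho> A < 1"
      using prob_le_1[of A] measure_nonneg[of \<rho> A] by (auto simp: less_le)
    define t where "t = measure \<rho> A"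
    have compl: "- A \<in> sets \<rho>" "measure \<rho> (- A) = 1 - t"
      using A(1) prob_compl[OF A(1)] sets.compl_sets[OF A(1)] by (auto simp: sp Compl_eq_Diff_UNIV t_def)
    define \<rho>1 where "\<rho>1 = uniform_measure \<rho> A"
    define \<rho>2 where "\<rho>2 = uniform_measure \<rho> (- A)"
    have inv: "invariant_borel_prob S \<rho>1" "invariant_borel_prob S \<rho>2"
      unfolding \<rho>1_def \<rho>2_def using A compl t
      by (auto intro!: invariant_uniform_measure[OF \<rho>] simp: sp t_def vimage_Compl)
    then have bp12: "borel_prob \<rho>1" "borel_prob \<rho>2" by (auto simp: invariant_borel_prob_iff)
    have split: "integral\<^sup>L \<rho> g = t * integral\<^sup>L \<rho>1 g + (1 - t) * integral\<^sup>L \<rho>2 g"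
      if g: "continuous_on UNIV g" for g :: "'b \<Rightarrow> real"
    proof -
      have ig: "integrable \<rho> g" by (rule int[OF bp g])
      have ii: "integrable \<rho> (\<lambda>x. indicator X x * g x)" if "X \<in> sets \<rho>" for X
        using integrable_real_mult_indicator[OF that ig] by (simp add: mult.commute)
      have "t * integral\<^sup>L \<rho>1 g = (\<integral>x. indicator A x * g x \<partial>\<rho>)"
        unfolding \<rho>1_def t_def using A(1) t(1) ig by (intro integral_uniform_measure) auto
      moreover have "(1 - t) * integral\<^sup>L \<rho>2 g = (\<integral>x. indicator (- A) x * g x \<partial>\<rho>)"
        using integral_uniform_measure[OF compl(1), of g] compl(2) t ig by (simp add: \<rho>2_def t_def)
      moreover have "(\<integral>x. indicator A x * g x \<partial>\<rho>) + (\<integral>x. indicator (- A) x * g x \<partial>\<rho>)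
          = (\<integral>x. indicator A x * g x + indicator (- A) x * g x \<partial>\<rho>)"
        by (intro Bochner_Integration.integral_add[symmetric] ii A(1) compl(1))
      moreover have "(\<lambda>x. indicator A x * g x + indicator (- A) x * g x) = g"
        by (auto simp: indicator_def)
      ultimately show ?thesis by simp
    qed
    define e where "e i = (1/2)^Suc i * (integral\<^sup>L \<rho>1 (h i) - integral\<^sup>L \<rho>2 (h i))\<^sup>2" for i
    \<comment> \<open>the defect of convexity of the square\<close>
    have e_eq: "t * (1 - t) * e i = t * q \<rho>1 i + (1 - t) * q \<rho>2 i - q \<rho> i" for i
      unfolding e_def q_def split[OF h(1)] by algebra
    have "summable (\<lambda>i. t * (1 - t) * e i)"
      unfolding e_eq using sq bp bp12 by (intro summable_add summable_diff summable_mult) auto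
    then have se: "summable e" using t by (simp add: t_def)
    have "t * (1 - t) * suminf e = (\<Sum>i. t * q \<rho>1 i + (1 - t) * q \<rho>2 i - q \<rho> i)"
      unfolding e_eq[symmetric] by (rule suminf_mult[OF se, symmetric])
    also have "\<dots> = t * suminf (q \<rho>1) + (1 - t) * suminf (q \<rho>2) - suminf (q \<rho>)"
      using sq[OF bp] sq[OF bp12(1)] sq[OF bp12(2)]
      by (simp add: suminf_add[symmetric] suminf_diff[symmetric] suminf_mult summable_add summable_mult)
    finally have Q: "t * (1 - t) * suminf e = t * suminf (q \<rho>1) + (1 - t) * suminf (q \<rho>2) - suminf (q \<rho>)" .
    have "\<delta> * (t * (1 - t) * suminf e) = t * \<Phi> \<rho>1 + (1 - t) * \<Phi> \<rho>2 - \<Phi> \<rho>"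
      unfolding \<Phi>_def split[OF \<phi>] Q by (simp add: algebra_simps)
    also have "\<dots> \<le> t * \<Phi> \<rho> + (1 - t) * \<Phi> \<rho> - \<Phi> \<rho>"
      using max[OF inv(1)] max[OF inv(2)] t
      by (intro diff_right_mono add_mono mult_left_mono) (auto simp: t_def)
    also have "\<dots> = 0" by (simp add: algebra_simps)
    finally have "suminf e \<le> 0"
      using \<open>\<delta> > 0\<close> t by (simp add: t_def mult_le_0_iff)
    then have "e i = 0" for i
      using suminf_eq_zero_iff[OF se] suminf_nonneg[OF se] by (fastforce simp: e_def)
    then have "integral\<^sup>L \<rho>1 (h i) = integral\<^sup>L \<rho>2 (h i)" for i
      by (simp add: e_def)
    then have "\<rho>1 = \<rho>2" using det bp12 by blast
    moreover have "measure \<rho>1 A = 1" "measure \<rho>2 A = 0"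
      using t A(1) compl by (auto simp: \<rho>1_def \<rho>2_def emeasure_eq_measure t_def)
    ultimately show False by simp
  qed
  then have "ergodic \<rho> S" using S\<rho> by (auto simp: ergodic_def intro: prob_space_axioms)
  moreover have "integral\<^sup>L \<rho>0 \<phi> - \<delta> \<le> integral\<^sup>L \<rho> \<phi>"
  proof -
    have "borel_prob \<rho>0" using \<rho>0 by (simp add: invariant_borel_prob_iff)
    then have "0 \<le> \<delta> * suminf (q \<rho>0)" using Q01(1) \<open>\<delta> > 0\<close> by simp
    moreover have "\<delta> * suminf (q \<rho>) \<le> \<delta>" using Q01(2)[OF bp] \<open>\<delta> > 0\<close> by simp
    ultimately show ?thesis using max[OF \<rho>0] by (simp add: \<Phi>_def)
  qed
  ultimately show ?thesis by (rule that[OF \<rho>])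
qed

text \<open>A weak limit of the empirical measures of the orbit along which the averages of $\<phi>$ exceed
  $\<beta>'$ is invariant and gives $\<phi>$ an integral of at least $\<beta>'$, hence so does, up to a small error,
  some ergodic measure. The constant $C$ takes care of the finitely many short sums; bounds of this shape
  can be added up without passing to limits.\<close>

theorem orbit_sums_le_ergodic_integrals:
  fixes S :: "'b::metric_space \<Rightarrow> 'b" and \<phi> :: "'b \<Rightarrow> real"
  assumes comp: "compact (UNIV :: 'b set)" and S: "continuous_on UNIV S"
    and \<phi>: "continuous_on UNIV \<phi>" and "\<beta> < \<beta>'"
    and erg: "\<And>\<rho>. invariant_borel_prob S \<rho> \<Longrightarrow> ergodic \<rho> S \<Longrightarrow> integral\<^sup>L \<rho> \<phi> \<le> \<beta>"
  shows "\<exists>C. \<forall>L. (\<Sum>l<L. \<phi> ((S ^^ l) y)) \<le> \<beta>' * real L + C"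
proof -
  have "\<exists>L0. \<forall>L\<ge>L0. (\<Sum>l<L. \<phi> ((S ^^ l) y)) \<le> \<beta>' * real L"
  proof (rule ccontr)
    assume "\<not> ?thesis"
    then have "\<forall>n. \<exists>L\<ge>Suc n. \<beta>' * real L < (\<Sum>l<L. \<phi> ((S ^^ l) y))" by (metis not_le)
    then obtain L where L: "\<And>n. Suc n \<le> L n"
      "\<And>n. \<beta>' * real (L n) < (\<Sum>l<L n. \<phi> ((S ^^ l) y))" by metis
    have Lpos: "L n > 0" for n using L(1)[of n] by simp
    define \<mu> where "\<mu> n = distr (uniform_count_measure {..<L n}) borel (\<lambda>l. (S ^^ l) y)" for n
    have m: "(\<lambda>l. (S ^^ l) y) \<in> uniform_count_measure {..<L n} \<rightarrow>\<^sub>M borel" for n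
      by (simp add: uniform_count_measure_def point_measure_def)
    have \<mu>: "borel_prob (\<mu> n)" for n
      using Lpos[of n] m[of n] unfolding \<mu>_def borel_prob_def
      by (auto intro!: prob_space.prob_space_distr prob_space_uniform_count_measure)
    have int: "integral\<^sup>L (\<mu> n) h = (\<Sum>l<L n. h ((S ^^ l) y)) / real (L n)"
      if "h \<in> borel_measurable borel" for h :: "'b \<Rightarrow> real" and n
      unfolding \<mu>_def using integral_distr[OF m that] by (simp add: integral_uniform_count_measure)
    have "(\<lambda>n. (\<integral>y. h (S y) \<partial>\<mu> n) - integral\<^sup>L (\<mu> n) h) \<longlonglongrightarrow> 0"
      if h: "continuous_on UNIV h" for h :: "'b \<Rightarrow> real"
    proof -
      have hS: "continuous_on UNIV (\<lambda>y. h (S y))" using continuous_on_compose2[OF h S] by simp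
      obtain B where B: "B > 0" "\<And>x. norm (h x) \<le> B" by (rule compact_UNIV_bounded[OF comp h]) (rule that)
      have "norm ((\<integral>y. h (S y) \<partial>\<mu> n) - integral\<^sup>L (\<mu> n) h) \<le> 2 * B * (1 / real (Suc n))" for n
      proof -
        have "(\<integral>y. h (S y) \<partial>\<mu> n) - integral\<^sup>L (\<mu> n) h
            = (\<Sum>l<L n. h ((S ^^ Suc l) y) - h ((S ^^ l) y)) / real (L n)"
          using int[OF borel_measurable_continuous_onI[OF h]] int[OF borel_measurable_continuous_onI[OF hS]]
          by (simp add: sum_subtractf diff_divide_distrib)
        also have "\<dots> = (h ((S ^^ L n) y) - h y) / real (L n)"
          using sum_lessThan_telescope[of "\<lambda>l. h ((S ^^ l) y)" "L n"] by simp
        finally have "norm ((\<integral>y. h (S y) \<partial>\<mu> n) - integral\<^sup>L (\<mu> n) h)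
            = norm (h ((S ^^ L n) y) - h y) / real (L n)"
          by (simp add: norm_divide)
        also have "\<dots> \<le> (2 * B) / real (L n)"
          using norm_triangle_ineq4[of "h ((S ^^ L n) y)" "h y"] B(2)[of "(S ^^ L n) y"] B(2)[of y]
          by (intro divide_right_mono) auto
        also have "\<dots> \<le> (2 * B) / real (Suc n)"
          using L(1)[of n] B(1) Lpos[of n] by (intro divide_left_mono) (auto intro: of_nat_mono)
        finally show ?thesis by simp
      qed
      moreover have "(\<lambda>n. 2 * B * (1 / real (Suc n))) \<longlonglongrightarrow> 0"
        by (intro tendsto_mult_right_zero LIMSEQ_inverse_real_of_nat[unfolded inverse_eq_divide])
      ultimately show ?thesis by (rule Lim_null_comparison[OF always_eventually[OF allI]])
    qed
    then have asymp: "\<forall>h :: 'b \<Rightarrow> real. continuous_on UNIV h \<longrightarrow>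
      (\<lambda>n. (\<integral>y. h (S y) \<partial>\<mu> n) - integral\<^sup>L (\<mu> n) h) \<longlonglongrightarrow> 0" by blast
    obtain r \<rho>0 where r: "strict_mono (r :: nat \<Rightarrow> nat)" and \<rho>0: "invariant_borel_prob S \<rho>0"
      and lim: "converges_weakly (\<lambda>n. \<mu> (r n)) \<rho>0"
      by (rule invariant_limit_measure[OF comp S \<mu> asymp]) (rule that)
    \<comment> \<open>the lower bound survives in the weak limit and, up to half the gap, in an ergodic measure\<close>
    have "\<beta>' \<le> integral\<^sup>L (\<mu> n) \<phi>" for n
      unfolding int[OF borel_measurable_continuous_onI[OF \<phi>]]
      using L(2)[of n] Lpos[of n] by (simp add: pos_le_divide_eq)
    then have "\<beta>' \<le> integral\<^sup>L \<rho>0 \<phi>" by (intro LIMSEQ_le_const[OF lim[unfolded converges_weakly_def, rule_format, OF \<phi>]]) auto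
    moreover obtain \<rho> where "invariant_borel_prob S \<rho>" "ergodic \<rho> S"
      "integral\<^sup>L \<rho> \<phi> \<ge> integral\<^sup>L \<rho>0 \<phi> - (\<beta>' - \<beta>) / 2"
      using exists_almost_maximal_ergodic_measure[OF comp S \<rho>0 \<phi>, of "(\<beta>' - \<beta>) / 2"] \<open>\<beta> < \<beta>'\<close> by auto
    ultimately show False using erg[of \<rho>] \<open>\<beta> < \<beta>'\<close> by (simp add: field_simps)
  qed
  then obtain L0 where L0: "\<And>L. L \<ge> L0 \<Longrightarrow> (\<Sum>l<L. \<phi> ((S ^^ l) y)) \<le> \<beta>' * real L" by blast
  define C where "C = (\<Sum>l<L0. \<bar>\<phi> ((S ^^ l) y)\<bar>) + \<bar>\<beta>'\<bar> * real L0"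
  have "(\<Sum>l<L. \<phi> ((S ^^ l) y)) \<le> \<beta>' * real L + C" for L
  proof (cases "L \<ge> L0")
    case True
    have "C \<ge> 0" unfolding C_def by (intro add_nonneg_nonneg sum_nonneg) auto
    then show ?thesis using L0[OF True] by simp
  next
    case False
    have "(\<Sum>l<L. \<phi> ((S ^^ l) y)) \<le> (\<Sum>l<L. \<bar>\<phi> ((S ^^ l) y)\<bar>)" by (intro sum_mono) auto
    also have "\<dots> \<le> (\<Sum>l<L0. \<bar>\<phi> ((S ^^ l) y)\<bar>)" using False by (intro sum_mono2) auto
    finally have "(\<Sum>l<L. \<phi> ((S ^^ l) y)) \<le> (\<Sum>l<L0. \<bar>\<phi> ((S ^^ l) y)\<bar>)" .
    moreover have "- (\<beta>' * real L) \<le> \<bar>\<beta>'\<bar> * real L0"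
    proof -
      have "- (\<beta>' * real L) \<le> \<bar>\<beta>'\<bar> * real L" by (simp add: abs_if)
      also have "\<dots> \<le> \<bar>\<beta>'\<bar> * real L0" using False by (intro mult_left_mono) auto
      finally show ?thesis .
    qed
    ultimately show ?thesis by (simp add: C_def)
  qed
  then show ?thesis by blast
qed

section \<open>Powers of a uniquely and totally ergodic map\<close>

text \<open>The set of points whose orbit visits $A$ infinitely often is strictly invariant, and it agrees with an
  almost invariant $A$ almost everywhere.\<close>

lemma ergodic_almost_invariant:
  assumes erg: "ergodic M S" and A: "A \<in> sets M"
    and inv: "AE x in M. S x \<in> A \<longleftrightarrow> x \<in> A"
  shows "(AE x in M. x \<in> A) \<or> (AE x in M. x \<notin> A)"
proof -
  interpret prob_space M using erg by (simp add: ergodic_def)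
  have S: "S \<in> M \<rightarrow>\<^sub>M M" "distr M M S = M" using erg by (auto simp: ergodic_def measure_preserving_def)
  have Sn: "(S ^^ n) \<in> M \<rightarrow>\<^sub>M M" for n using S(1) by (rule measurable_compose_n)
  have "AE x in M. (S ^^ n) x \<in> A \<longleftrightarrow> x \<in> A" for n
  proof (induction n)
    case (Suc n)
    have "AE x in M. (S ^^ n) (S x) \<in> A \<longleftrightarrow> S x \<in> A"
      by (rule AE_distrD[OF S(1), unfolded S(2), OF Suc])
    then show ?case using inv by eventually_elim (simp add: funpow_swap1)
  qed simp
  then have all: "AE x in M. \<forall>n. (S ^^ n) x \<in> A \<longleftrightarrow> x \<in> A" by (simp add: AE_all_countable)
  define A' where "A' = {x \<in> space M. \<forall>n. \<exists>m\<ge>n. (S ^^ m) x \<in> A}"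
  have ae: "AE x in M. x \<in> A' \<longleftrightarrow> x \<in> A"
    using all AE_space by eventually_elim (auto simp: A'_def)
  have A': "A' \<in> sets M"
  proof -
    have "A' = (\<Inter>n. \<Union>m\<in>{n..}. (S ^^ m) -` A \<inter> space M)"
      by (auto simp: A'_def Bex_def)
    moreover have "(\<Union>m\<in>{n..}. (S ^^ m) -` A \<inter> space M) \<in> sets M" for n
      by (rule sets.countable_UN'') (auto intro: measurable_sets[OF Sn A])
    ultimately show ?thesis by (simp only:) (intro sets.countable_INT image_subsetI UNIV_not_empty)
  qed
  have "S -` A' \<inter> space M = A'"
  proof -
    have "(\<forall>n. \<exists>m\<ge>n. (S ^^ m) (S x) \<in> A) \<longleftrightarrow> (\<forall>n. \<exists>m\<ge>n. (S ^^ m) x \<in> A)" (is "?l \<longleftrightarrow> ?r") for x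
    proof (intro iffI allI)
      fix n assume ?l
      then obtain m where "m \<ge> n" "(S ^^ m) (S x) \<in> A" by blast
      then show "\<exists>m\<ge>n. (S ^^ m) x \<in> A" by (intro exI[of _ "Suc m"]) (simp add: funpow_swap1)
    next
      fix n assume ?r
      then obtain m where m: "m \<ge> Suc n" "(S ^^ m) x \<in> A" by blast
      then obtain l where "m = Suc l" using Suc_le_D by blast
      then show "\<exists>m\<ge>n. (S ^^ m) (S x) \<in> A" using m by (intro exI[of _ l]) (simp add: funpow_swap1)
    qed
    then show ?thesis using measurable_space[OF S(1)] by (auto simp: A'_def)
  qed
  then have "measure M A' = 0 \<or> measure M A' = 1" using erg A' by (auto simp: ergodic_def)
  then show ?thesis
  proof
    assume "measure M A' = 0"
    then have "AE x in M. x \<notin> A'" using A' by (simp add: prob_eq_0)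
    then have "AE x in M. x \<notin> A" using ae by eventually_elim simp
    then show ?thesis ..
  next
    assume "measure M A' = 1"
    then have "AE x in M. x \<in> A'" using A' by (simp add: prob_eq_1)
    then have "AE x in M. x \<in> A" using ae by eventually_elim simp
    then show ?thesis ..
  qed
qed

text \<open>Let $g + 1$ be the density of $\<nu>$ and $A = \{g > 0\}$. The signed measure $\<nu> - M$ gives $A$ and
  $S^{-1}A$ the same mass, but $A$ is, up to null sets, the only set where this mass is maximal among sets
  of the same $M$-measure; so $A$ is almost invariant, hence null or full, and $g$, which has integral 0,
  vanishes.\<close>

theorem absolutely_continuous_invariant_eq_ergodic:
  assumes erg: "ergodic M S" and \<nu>: "prob_space \<nu>" "sets \<nu> = sets M" "measure_preserving \<nu> S"
    and ac: "absolutely_continuous M \<nu>"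
  shows "\<nu> = M"
proof -
  interpret M: prob_space M using erg by (simp add: ergodic_def)
  interpret \<nu>: prob_space \<nu> by (rule \<nu>(1))
  have S: "S \<in> M \<rightarrow>\<^sub>M M" "distr M M S = M" using erg by (auto simp: ergodic_def measure_preserving_def)
  have S\<nu>: "S \<in> \<nu> \<rightarrow>\<^sub>M \<nu>" "distr \<nu> \<nu> S = \<nu>" using \<nu>(3) by (auto simp: measure_preserving_def)
  have sp: "space \<nu> = space M" by (rule sets_eq_imp_space_eq[OF \<nu>(2)])
  obtain D where D: "D \<in> borel_measurable M" "AE x in M. RN_deriv M \<nu> x = ennreal (D x)" "\<And>x. 0 \<le> D x"
    using M.real_RN_deriv[OF \<nu>.finite_measure_axioms ac \<nu>(2)] by metis
  have dens: "density M (\<lambda>x. ennreal (D x)) = \<nu>"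
  proof -
    have "density M (\<lambda>x. ennreal (D x)) = density M (RN_deriv M \<nu>)"
      using D(1,2) by (intro density_cong) auto
    then show ?thesis using M.density_RN_deriv[OF ac \<nu>(2)] by simp
  qed
  have iD: "integrable M D"
  proof (rule integrableI_nonneg)
    have "(\<integral>\<^sup>+ x. ennreal (D x) \<partial>M) = emeasure (density M (\<lambda>x. ennreal (D x))) (space M)"
      using D(1) by (subst emeasure_density) (auto intro!: nn_integral_cong)
    also have "\<dots> = 1" unfolding dens using \<nu>.emeasure_space_1 by (simp add: sp)
    finally show "(\<integral>\<^sup>+ x. ennreal (D x) \<partial>M) < \<infinity>" by simp
  qed (use D in auto)
  define g where "g x = D x - 1" for x
  have g: "g \<in> borel_measurable M" "integrable M g"
    unfolding g_def using D(1) iD by auto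
  have diff: "measure \<nu> B - measure M B = (\<integral>x. indicator B x * g x \<partial>M)" if B: "B \<in> sets M" for B
  proof -
    have "measure \<nu> B = (\<integral>x. indicator B x \<partial>density M (\<lambda>x. ennreal (D x)))"
      using B sets.sets_into_space[OF B] by (simp add: dens sp Int_absorb1 Int_absorb2)
    also have "\<dots> = (\<integral>x. D x *\<^sub>R indicator B x \<partial>M)"
      using B D by (intro integral_density) auto
    also have "\<dots> = (\<integral>x. D x * indicator B x \<partial>M)" by simp
    finally have 1: "measure \<nu> B = (\<integral>x. D x * indicator B x \<partial>M)" .
    have 2: "measure M B = (\<integral>x. indicator B x \<partial>M)"
      using B sets.sets_into_space[OF B] by (simp add: Int_absorb1 Int_absorb2)
    have "integrable M (\<lambda>x. D x * indicator B x)" by (rule integrable_real_mult_indicator[OF B iD])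
    moreover have "integrable M (indicator B :: _ \<Rightarrow> real)" using B by (intro M.integrable_const_bound[of _ 1]) auto
    ultimately have "measure \<nu> B - measure M B = (\<integral>x. D x * indicator B x - indicator B x \<partial>M)"
      unfolding 1 2 by (simp add: Bochner_Integration.integral_diff)
    then show ?thesis by (simp add: g_def algebra_simps)
  qed
  define A where "A = {x \<in> space M. g x > 0}"
  have A: "A \<in> sets M" unfolding A_def using g(1) by measurable
  have SA: "S -` A \<inter> space M \<in> sets M" by (rule measurable_sets[OF S(1) A])
  have pres: "measure M (S -` A \<inter> space M) = measure M A" "measure \<nu> (S -` A \<inter> space M) = measure \<nu> A"
    using measure_distr[OF S(1) A] measure_distr[OF S\<nu>(1), of A] A by (simp_all add: S(2) S\<nu>(2) sp \<nu>(2))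
  define B where "B = S -` A \<inter> space M"
  have intg: "integrable M (\<lambda>x. indicator X x * g x)" if "X \<in> sets M" for X
    using integrable_real_mult_indicator[OF that g(2)] by (simp add: mult.commute)
  \<comment> \<open>$w \<ge> 0$ because $g > 0$ on $A$ and $g \<le> 0$ off $A$, so that $w$, of integral 0, vanishes\<close>
  define w where "w x = indicator A x * g x - indicator B x * g x" for x
  have "integral\<^sup>L M w = 0"
    unfolding w_def B_def using diff[OF A] diff[OF SA] pres intg[OF A] intg[OF SA] by simp
  moreover have "integrable M w" unfolding w_def using intg A SA by (auto simp: B_def)
  moreover have "AE x in M. 0 \<le> w x"
    by (rule AE_I2) (auto simp: w_def A_def indicator_def)
  ultimately have "AE x in M. w x = 0" by (simp add: integral_nonneg_eq_0_iff_AE)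
  then have "AE x in M. x \<in> A \<longrightarrow> x \<in> B"
    by eventually_elim (auto simp: w_def A_def indicator_def split: if_splits)
  then have "measure M (A - B) = 0"
    using A SA by (subst M.prob_eq_0) (auto simp: B_def)
  have mAB: "measure M (A \<inter> B) = measure M A"
    using M.finite_measure_Diff'[of A B] \<open>measure M (A - B) = 0\<close> A SA by (simp add: B_def)
  then have "measure M (B - A) = 0"
    using M.finite_measure_Diff'[of B A] pres(1) A SA by (simp add: B_def Int_commute)
  then have "AE x in M. x \<notin> B - A"
    using A SA by (subst (asm) M.prob_eq_0) (auto simp: B_def)
  then have "AE x in M. S x \<in> A \<longleftrightarrow> x \<in> A"
    using \<open>AE x in M. x \<in> A \<longrightarrow> x \<in> B\<close> AE_space by eventually_elim (auto simp: B_def)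
  then have "(AE x in M. x \<in> A) \<or> (AE x in M. x \<notin> A)" by (rule ergodic_almost_invariant[OF erg A])
  moreover have int0: "integral\<^sup>L M g = 0"
  proof -
    have "integral\<^sup>L M g = (\<integral>x. indicator (space M) x * g x \<partial>M)" by (intro Bochner_Integration.integral_cong) auto
    also have "\<dots> = 0" using diff[OF sets.top] M.prob_space \<nu>.prob_space by (simp add: sp)
    finally show ?thesis .
  qed
  ultimately have "AE x in M. g x = 0"
  proof (elim disjE)
    assume "AE x in M. x \<in> A"
    then have "AE x in M. 0 \<le> g x" by eventually_elim (simp add: A_def)
    then show ?thesis using int0 g(2) by (simp add: integral_nonneg_eq_0_iff_AE)
  next
    assume "AE x in M. x \<notin> A"
    then have "AE x in M. 0 \<le> - g x" using AE_space by eventually_elim (simp add: A_def)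
    then have "AE x in M. - g x = 0"
      using int0 g(2) integral_nonneg_eq_0_iff_AE[of M "\<lambda>x. - g x"] by simp
    then show ?thesis by simp
  qed
  show "\<nu> = M"
  proof (rule measure_eqI[OF \<nu>(2)])
    fix X assume "X \<in> sets \<nu>"
    then have X: "X \<in> sets M" by (simp add: \<nu>(2))
    have "(\<integral>x. indicator X x * g x \<partial>M) = (\<integral>x. 0 \<partial>M)"
      using \<open>AE x in M. g x = 0\<close> X g(1) by (intro integral_cong_AE) auto
    then show "emeasure \<nu> X = emeasure M X"
      using diff[OF X] by (simp add: M.emeasure_eq_measure \<nu>.emeasure_eq_measure)
  qed
qed

text \<open>The average $\<kappa>$ of the images of $\<nu>$ under $T^i$, $i < p$, is $T$-invariant, hence equal to $M$. As
  $\<nu> \<le> p\<kappa>$, the measure $\<nu>$ is absolutely continuous with respect to $M$, which is ergodic for $T^p$. The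
  average is formed as the mixture of the image measures under the uniform distribution of $i$.\<close>

theorem power_uniquely_ergodic:
  fixes T :: "'a::topological_space \<Rightarrow> 'a"
  assumes T: "T \<in> borel \<rightarrow>\<^sub>M borel" and ue: "uniquely_ergodic T M" and "p > 0"
    and erg: "ergodic M (T ^^ p)" and \<nu>: "invariant_borel_prob (T ^^ p) \<nu>"
  shows "\<nu> = M"
proof -
  have Tn: "(T ^^ n) \<in> borel \<rightarrow>\<^sub>M borel" for n using T by (rule measurable_compose_n)
  have bp: "borel_prob \<nu>" using \<nu> by (simp add: invariant_borel_prob_iff)
  have M: "borel_prob M" using ue by (simp add: uniquely_ergodic_def invariant_borel_prob_iff)
  have p: "{..<p} \<noteq> {}" "finite {..<p}" using \<open>p > 0\<close> by auto
  define \<nu>' where "\<nu>' i = distr \<nu> borel (T ^^ i)" for i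
  have \<nu>': "borel_prob (\<nu>' i)" for i unfolding \<nu>'_def by (rule borel_prob_distr[OF bp Tn])
  have meas: "\<nu>' \<in> measure_pmf (pmf_of_set {..<p}) \<rightarrow>\<^sub>M subprob_algebra borel"
    using \<nu>' by (auto simp: space_subprob_algebra borel_prob_def prob_space_imp_subprob_space)
  define \<kappa> where "\<kappa> = measure_pmf (pmf_of_set {..<p}) \<bind> \<nu>'"
  have \<kappa>: "borel_prob \<kappa>"
    unfolding borel_prob_def
  proof
    show "prob_space \<kappa>" unfolding \<kappa>_def
      using \<nu>' meas by (intro measure_pmf.prob_space_bind) (auto simp: borel_prob_def)
    show "sets \<kappa> = sets borel" unfolding \<kappa>_def using meas by (rule sets_bind_measurable) simp
  qed
  have em: "emeasure \<kappa> B = (\<Sum>i<p. emeasure \<nu> ((T ^^ i) -` B)) / of_nat p" if B: "B \<in> sets borel" for B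
  proof -
    have "emeasure \<kappa> B = (\<integral>\<^sup>+ i. emeasure (\<nu>' i) B \<partial>measure_pmf (pmf_of_set {..<p}))"
      unfolding \<kappa>_def using meas B by (intro emeasure_bind) auto
    also have "\<dots> = (\<Sum>i<p. emeasure (\<nu>' i) B) / of_nat p"
      using nn_integral_pmf_of_set[OF p] by simp
    also have "(\<Sum>i<p. emeasure (\<nu>' i) B) = (\<Sum>i<p. emeasure \<nu> ((T ^^ i) -` B))"
      unfolding \<nu>'_def using B borel_prob_space[OF bp]
      by (intro sum.cong refl) (simp add: emeasure_distr[OF borel_prob_measurable[OF bp Tn]])
    finally show ?thesis .
  qed
  have "invariant_borel_prob T \<kappa>"
    unfolding invariant_borel_prob_iff_distr[OF \<kappa> T]
  proof (rule measure_eqI)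
    show "sets (distr \<kappa> borel T) = sets \<kappa>" using \<kappa> by (simp add: borel_prob_def)
    fix B assume "B \<in> sets (distr \<kappa> borel T)"
    then have B: "B \<in> sets borel" by simp
    have TB: "T -` B \<in> sets borel" using measurable_sets[OF T B] by simp
    obtain k where k: "p = Suc k" using \<open>p > 0\<close> gr0_implies_Suc by blast
    have "distr \<nu> borel (T ^^ p) = \<nu>" using \<nu> invariant_borel_prob_iff_distr[OF bp Tn] by simp
    then have per: "emeasure \<nu> ((T ^^ p) -` B) = emeasure \<nu> B"
      using emeasure_distr[OF borel_prob_measurable[OF bp Tn[of p]] B] borel_prob_space[OF bp] by simp
    have "emeasure (distr \<kappa> borel T) B = emeasure \<kappa> (T -` B)"
      using emeasure_distr[OF borel_prob_measurable[OF \<kappa> T] B] borel_prob_space[OF \<kappa>] by simp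
    also have "\<dots> = (\<Sum>i<p. emeasure \<nu> ((T ^^ Suc i) -` B)) / of_nat p"
      unfolding em[OF TB] by (simp add: vimage_comp o_def)
    also have "(\<Sum>i<p. emeasure \<nu> ((T ^^ Suc i) -` B)) = (\<Sum>i<p. emeasure \<nu> ((T ^^ i) -` B))"
      using per unfolding k sum.lessThan_Suc_shift[of "\<lambda>i. emeasure \<nu> ((T ^^ i) -` B)" k]
      by (simp only: sum.lessThan_Suc) (simp add: add.commute)
    also have "\<dots> / of_nat p = emeasure \<kappa> B" by (rule em[OF B, symmetric])
    finally show "emeasure (distr \<kappa> borel T) B = emeasure \<kappa> B" .
  qed
  then have \<kappa>M: "\<kappa> = M" using ue by (simp add: uniquely_ergodic_def)
  have "absolutely_continuous M \<nu>"
    unfolding absolutely_continuous_def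
  proof
    fix B assume "B \<in> null_sets M"
    then have B: "B \<in> sets borel" "emeasure \<kappa> B = 0" using M by (auto simp: \<kappa>M borel_prob_def)
    then have "(\<Sum>i<p. emeasure \<nu> ((T ^^ i) -` B)) = 0"
      using em[OF B(1)] \<open>p > 0\<close> by (auto simp: ennreal_divide_eq_0_iff)
    then have "emeasure \<nu> ((T ^^ 0) -` B) = 0" using \<open>p > 0\<close> by (simp add: sum_eq_0_iff del: funpow.simps) 
    then show "B \<in> null_sets \<nu>" using B(1) bp by (auto simp: borel_prob_def null_sets_def)
  qed
  moreover have "sets \<nu> = sets M" using bp M by (simp add: borel_prob_def)
  ultimately show ?thesis
    using absolutely_continuous_invariant_eq_ergodic[OF erg] \<nu> bp
    by (simp add: borel_prob_def invariant_borel_prob_iff)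
qed

section \<open>Correlations along orbits\<close>

lemma invariant_borel_prob_factor:
  assumes \<rho>: "invariant_borel_prob S \<rho>"
    and meas: "S \<in> borel \<rightarrow>\<^sub>M borel" "\<pi> \<in> borel \<rightarrow>\<^sub>M borel" "R \<in> borel \<rightarrow>\<^sub>M borel"
    and comm: "\<pi> \<circ> S = R \<circ> \<pi>"
  shows "invariant_borel_prob R (distr \<rho> borel \<pi>)"
proof -
  have bp: "borel_prob \<rho>" using \<rho> by (simp add: invariant_borel_prob_iff)
  note m = borel_prob_measurable[OF bp]
  have "distr (distr \<rho> borel \<pi>) borel R = distr \<rho> borel (R \<circ> \<pi>)"
    by (rule distr_distr[OF meas(3) m[OF meas(2)]])
  also have "\<dots> = distr (distr \<rho> borel S) borel \<pi>"
    unfolding comm[symmetric] by (rule distr_distr[OF meas(2) m[OF meas(1)], symmetric])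
  also have "distr \<rho> borel S = \<rho>" using \<rho> invariant_borel_prob_iff_distr[OF bp meas(1)] by simp
  finally show ?thesis
    by (simp add: invariant_borel_prob_iff_distr[OF borel_prob_distr[OF bp meas(2)] meas(3)])
qed

lemma continuous_on_funpow:
  fixes T :: "'a::topological_space \<Rightarrow> 'a"
  assumes "continuous_on UNIV T"
  shows "continuous_on UNIV (T ^^ n)"
proof (induction n)
  case (Suc n)
  then show ?case using continuous_on_compose2[OF assms Suc] by (simp add: o_def)
qed (simp add: continuous_on_id id_def)

lemma map_prod_funpow:
  fixes f :: "'a \<Rightarrow> 'a" and g :: "'b \<Rightarrow> 'b"
  shows "(map_prod f g ^^ n) (x, y) = ((f ^^ n) x, (g ^^ n) y)"
  by (induction n) simp_all

lemma continuous_on_map_prod: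
  assumes "continuous_on UNIV f" "continuous_on UNIV g"
  shows "continuous_on UNIV (map_prod f g)"
proof -
  have "continuous_on UNIV (\<lambda>w. (f (fst w), g (snd w)))"
    by (intro continuous_on_Pair continuous_on_compose2[OF assms(1)] continuous_on_compose2[OF assms(2)]
        continuous_on_fst continuous_on_snd continuous_on_id) auto
  then show ?thesis by (simp add: map_prod_def case_prod_unfold)
qed

text \<open>The marginals come for free: they are invariant under the powers, which are uniquely ergodic.\<close>

lemma ergodic_joining_of_powers:
  fixes T :: "'a::metric_space \<Rightarrow> 'a"
  assumes comp: "compact (UNIV :: 'a set)" and T: "continuous_on UNIV T"
    and ue: "uniquely_ergodic T M" and te: "totally_ergodic M T" and pq: "p > 0" "q > 0"
    and \<rho>: "invariant_borel_prob (map_prod (T ^^ p) (T ^^ q)) \<rho>"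
      "ergodic \<rho> (map_prod (T ^^ p) (T ^^ q))"
  shows "\<rho> \<in> ergodic_joinings M (T ^^ p) M (T ^^ q)"
proof -
  have M: "sets M = sets borel" using ue by (simp add: uniquely_ergodic_def invariant_borel_prob_def)
  have bp: "borel_prob \<rho>" using \<rho>(1) by (simp add: invariant_borel_prob_iff)
  have mT: "T \<in> borel \<rightarrow>\<^sub>M borel" by (rule borel_measurable_continuous_onI[OF T])
  have mTn: "(T ^^ n) \<in> borel \<rightarrow>\<^sub>M borel" for n
    by (rule borel_measurable_continuous_onI[OF continuous_on_funpow[OF T]])
  have S: "map_prod (T ^^ p) (T ^^ q) \<in> borel \<rightarrow>\<^sub>M borel"
    by (intro borel_measurable_continuous_onI continuous_on_map_prod continuous_on_funpow T)
  have fs: "fst \<in> borel \<rightarrow>\<^sub>M (borel :: 'a measure)" "snd \<in> borel \<rightarrow>\<^sub>M (borel :: 'a measure)"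
    by (auto intro!: borel_measurable_continuous_onI continuous_intros)
  have erg: "ergodic M (T ^^ n)" if "n > 0" for n using te that by (simp add: totally_ergodic_def)
  have "distr \<rho> borel fst = M"
    by (rule power_uniquely_ergodic[OF mT ue pq(1) erg[OF pq(1)]
          invariant_borel_prob_factor[OF \<rho>(1) S fs(1) mTn]]) (auto simp: fun_eq_iff)
  moreover have "distr \<rho> M fst = distr \<rho> borel fst" by (rule distr_cong) (auto simp: M)
  moreover have "distr \<rho> borel snd = M"
    by (rule power_uniquely_ergodic[OF mT ue pq(2) erg[OF pq(2)]
          invariant_borel_prob_factor[OF \<rho>(1) S fs(2) mTn]]) (auto simp: fun_eq_iff)
  moreover have "distr \<rho> M snd = distr \<rho> borel snd" by (rule distr_cong) (auto simp: M)
  moreover have "sets \<rho> = sets (M \<Otimes>\<^sub>M M)"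
    using bp sets_pair_measure_cong[OF M M] sets_borel_pair_compact_metric[OF comp]
    by (simp add: borel_prob_def)
  ultimately show ?thesis
    using bp \<rho> by (simp add: ergodic_joinings_def joinings_def invariant_borel_prob_iff borel_prob_def)
qed

text \<open>Multiplying by the four units turns bounds for real parts into bounds for the absolute values of the
  real and the imaginary part.\<close>

lemma norm_sum_le_of_four_sides:
  fixes F :: "nat \<Rightarrow> complex"
  assumes "\<And>c. c \<in> {1, -1, \<i>, -\<i>} \<Longrightarrow> \<exists>C. \<forall>L. (\<Sum>l<L. Re (c * F l)) \<le> \<beta> * real L + C"
  shows "\<exists>C. \<forall>L. norm (\<Sum>l<L. F l) \<le> 2 * \<beta> * real L + C"
proof -
  obtain C where C: "\<And>c L. c \<in> {1, -1, \<i>, -\<i>} \<Longrightarrow> (\<Sum>l<L. Re (c * F l)) \<le> \<beta> * real L + C c"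
    using assms by metis
  define K where "K = \<bar>C 1\<bar> + \<bar>C (-1)\<bar> + \<bar>C \<i>\<bar> + \<bar>C (-\<i>)\<bar>"
  have "norm (\<Sum>l<L. F l) \<le> 2 * \<beta> * real L + 2 * K" for L
  proof -
    define s where "s = (\<Sum>l<L. F l)"
    have c: "Re (c * s) \<le> \<beta> * real L + C c" if "c \<in> {1, -1, \<i>, -\<i>}" for c
      using C[OF that, of L] unfolding s_def by (simp only: sum_distrib_left Re_sum)
    have "\<bar>Re s\<bar> \<le> \<beta> * real L + K" "\<bar>Im s\<bar> \<le> \<beta> * real L + K"
      using c[of 1] c[of "-1"] c[of \<i>] c[of "-\<i>"] unfolding K_def by auto
    then show ?thesis using cmod_le[of s] by (simp add: s_def)
  qed
  then show ?thesis by blast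
qed

text \<open>The correlation sums are orbit sums of $f \<otimes> \bar f$ at the point $(y,z)$ under $T^p \<times> T^q$, whose
  ergodic invariant measures are exactly the ergodic joinings to which the AOP property refers.\<close>

theorem AOP_orbit_correlations:
  fixes T :: "'a::metric_space \<Rightarrow> 'a" and f :: "'a \<Rightarrow> complex"
  assumes comp: "compact (UNIV :: 'a set)" and T: "continuous_on UNIV T"
    and ue: "uniquely_ergodic T M" and aop: "AOP M T"
    and f: "continuous_on UNIV f" "integral\<^sup>L M f = 0" and "\<epsilon> > 0"
  shows "\<exists>P. \<forall>p q y z. prime p \<and> prime q \<and> p \<noteq> q \<and> p \<ge> P \<and> q \<ge> P \<longrightarrow>
           (\<exists>C. \<forall>L. norm (\<Sum>l<L. f ((T ^^ (p * l)) y) * cnj (f ((T ^^ (q * l)) z))) \<le> \<epsilon> * real L + C)"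
proof -
  have M: "borel_prob M" using ue by (simp add: uniquely_ergodic_def invariant_borel_prob_iff)
  have te: "totally_ergodic M T" using aop by (simp add: AOP_def)
  have "continuous_on UNIV (\<lambda>x. (norm (f x))\<^sup>2)" using f(1) by (intro continuous_intros)
  then have fL2: "f \<in> zero_mean_L2 M"
    using borel_prob_measurable[OF M borel_measurable_continuous_onI[OF f(1)]] f(2)
      integrable_continuous_borel_prob[OF comp M, of "\<lambda>x. (norm (f x))\<^sup>2"]
    by (simp add: zero_mean_L2_def)
  have cL2: "(\<lambda>x. cnj (f x)) \<in> zero_mean_L2 M"
  proof -
    have cf: "continuous_on UNIV (\<lambda>x. cnj (f x))" using f(1) by (intro continuous_intros)
    show ?thesis
      using borel_prob_measurable[OF M borel_measurable_continuous_onI[OF cf]] f(2) fL2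
      by (auto simp: zero_mean_L2_def)
  qed
  define J where "J p q = (SUP \<rho>\<in>ergodic_joinings M (T ^^ p) M (T ^^ q).
      ennreal (norm (\<integral>z. f (fst z) * cnj (f (snd z)) \<partial>\<rho>)))" for p q
  \<comment> \<open>the bound $\<epsilon>/4$ for integrals leaves room for $\<epsilon>/2$ along orbits and for the factor 2 of the four sides\<close>
  have "Limsup distinct_primes_at_top (\<lambda>(p, q). J p q) = 0"
    unfolding J_def using aop[unfolded AOP_def, THEN conjunct2, rule_format, OF fL2 cL2] .
  then have "Limsup distinct_primes_at_top (\<lambda>(p, q). J p q) < ennreal (\<epsilon> / 4)"
    using \<open>\<epsilon> > 0\<close> by simp
  then have "\<forall>\<^sub>F (p, q) in distinct_primes_at_top. J p q < ennreal (\<epsilon> / 4)"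
    by (auto dest: Limsup_lessD simp: case_prod_unfold)
  then obtain P where P: "\<And>p q. \<lbrakk>q \<ge> P; p \<ge> P; prime p; prime q; p \<noteq> q\<rbrakk> \<Longrightarrow> J p q < ennreal (\<epsilon> / 4)"
    unfolding distinct_primes_at_top_def eventually_inf_principal eventually_prod_sequentially
    by auto
  have "\<exists>C. \<forall>L. norm (\<Sum>l<L. f ((T ^^ (p * l)) y) * cnj (f ((T ^^ (q * l)) z))) \<le> \<epsilon> * real L + C"
    if pq: "prime p" "prime q" "p \<noteq> q" "p \<ge> P" "q \<ge> P" for p q y z
  proof -
    define S where "S = map_prod (T ^^ p) (T ^^ q)"
    define F where "F w = f (fst w) * cnj (f (snd w))" for w
    have comp2: "compact (UNIV :: ('a \<times> 'a) set)"
      using compact_Times[OF comp comp] by simp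
    have S: "continuous_on UNIV S"
        unfolding S_def by (intro continuous_on_map_prod continuous_on_funpow T)
    have F: "continuous_on UNIV F"
      unfolding F_def using f(1) by (auto intro!: continuous_intros continuous_on_compose2[of UNIV f])
    have bound: "norm (integral\<^sup>L \<rho> F) \<le> \<epsilon> / 4"
      if \<rho>: "invariant_borel_prob S \<rho>" "ergodic \<rho> S" for \<rho>
    proof -
      have "\<rho> \<in> ergodic_joinings M (T ^^ p) M (T ^^ q)"
        using ergodic_joining_of_powers[OF comp T ue te] \<rho> pq prime_gt_0_nat unfolding S_def by blast
      then have "ennreal (norm (integral\<^sup>L \<rho> F)) \<le> J p q"
        unfolding J_def F_def by (rule SUP_upper)
      also have "\<dots> \<le> ennreal (\<epsilon> / 4)" using P[OF pq(5,4,1,2,3)] by simp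
      finally show ?thesis using \<open>\<epsilon> > 0\<close> by (simp add: ennreal_le_iff)
    qed
    have orbit: "F ((S ^^ l) (y, z)) = f ((T ^^ (p * l)) y) * cnj (f ((T ^^ (q * l)) z))" for l
      by (simp add: F_def S_def map_prod_funpow funpow_mult)
    have "\<exists>C. \<forall>L. (\<Sum>l<L. Re (c * F ((S ^^ l) (y, z)))) \<le> \<epsilon> / 2 * real L + C"
      if c: "c \<in> {1, -1, \<i>, -\<i>}" for c
    proof (rule orbit_sums_le_ergodic_integrals[OF comp2 S, where \<beta> = "\<epsilon> / 4"])
      show "continuous_on UNIV (\<lambda>w. Re (c * F w))" using F by (intro continuous_intros)
      show "\<epsilon> / 4 < \<epsilon> / 2" using \<open>\<epsilon> > 0\<close> by simp
      fix \<rho> assume \<rho>: "invariant_borel_prob S \<rho>" "ergodic \<rho> S"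
      have "integrable \<rho> F"
        using \<rho>(1) by (intro integrable_continuous_borel_prob[OF comp2 _ F]) (simp add: invariant_borel_prob_iff)
      then have "(\<integral>w. Re (c * F w) \<partial>\<rho>) = Re (c * integral\<^sup>L \<rho> F)" by simp
      also have "\<dots> \<le> norm (c * integral\<^sup>L \<rho> F)" by (rule complex_Re_le_cmod)
      also have "\<dots> = norm (integral\<^sup>L \<rho> F)" using c by (auto simp: norm_mult)
      finally show "(\<integral>w. Re (c * F w) \<partial>\<rho>) \<le> \<epsilon> / 4" using bound[OF \<rho>] by simp
    qed
    from norm_sum_le_of_four_sides[OF this] show ?thesis unfolding orbit by simp
  qed
  then show ?thesis by blast
qed

section \<open>The sum of the reciprocals of the primes\<close>

lemma squarefree_eq_prod_prime_factors:
  fixes n :: nat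
  assumes "squarefree n"
  shows "\<Prod>(prime_factors n) = n"
proof -
  have n: "n \<noteq> 0" using assms by (metis not_squarefree_0)
  have "n = (\<Prod>p\<in>prime_factors n. p ^ multiplicity p n)"
    using n by (simp add: prime_factorization_nat)
  also have "\<dots> = (\<Prod>p\<in>prime_factors n. p)"
    using assms n by (intro prod.cong refl) (auto simp: squarefree_factorial_semiring')
  finally show ?thesis by simp
qed

text \<open>Such a number is determined by the square it contains, at most $m^2$, and by the set of the primes below
  $K$ that divide its squarefree part.\<close>

lemma card_small_prime_factors_le:
  "card {n\<in>{1..m\<^sup>2}. \<forall>p. prime p \<longrightarrow> p dvd n \<longrightarrow> p < K} \<le> 2 ^ K * m" (is "card ?B \<le> _")
proof -
  define g where "g n = (prime_factors (squarefree_part n), square_part n)" for n :: nat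
  have "inj_on g ?B"
  proof (rule inj_onI)
    fix n n' assume "g n = g n'"
    then have eq: "prime_factors (squarefree_part n) = prime_factors (squarefree_part n')"
      "square_part n = square_part n'" by (simp_all only: g_def prod.inject)
    have "squarefree_part n = squarefree_part n'"
      by (subst (1 2) squarefree_eq_prod_prime_factors[OF squarefree_squarefree_part, symmetric])
         (simp only: eq(1))
    with eq(2) show "n = n'"
      by (subst (1 2) squarefree_decompose) simp
  qed
  moreover have "g ` ?B \<subseteq> Pow {..<K} \<times> {1..m}"
  proof (rule image_subsetI)
    fix n assume n: "n \<in> ?B"
    have "p < K" if p: "p \<in> prime_factors (squarefree_part n)" for p
    proof -
      have "squarefree_part n dvd n"
        using dvd_triv_left[of "squarefree_part n" "(square_part n)\<^sup>2"] squarefree_decompose[of n] by simp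
      then have "p dvd n" using p by (auto dest: in_prime_factors_imp_dvd dvd_trans)
      then show ?thesis using n p in_prime_factors_imp_prime by blast
    qed
    moreover have "square_part n \<le> m"
    proof -
      have "(square_part n)\<^sup>2 \<le> n" using n by (intro dvd_imp_le) auto
      also have "n \<le> m\<^sup>2" using n by simp
      finally have "(square_part n)\<^sup>2 \<le> m\<^sup>2" .
      then show ?thesis by (rule power2_le_imp_le) simp
    qed
    moreover have "square_part n \<noteq> 0" using n by simp
    then have "square_part n \<ge> 1" by linarith
    ultimately show "g n \<in> Pow {..<K} \<times> {1..m}" by (auto simp: g_def)
  qed
  ultimately have "card ?B \<le> card (Pow {..<K} \<times> {1..m})" by (intro card_inj_on_le) auto
  then show ?thesis by (simp add: card_cartesian_product card_Pow)
qed

lemma sum_over_multiples: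
  fixes f :: "nat \<Rightarrow> 'a::comm_monoid_add"
  assumes "d > 0"
  shows "(\<Sum>n=1..N. if d dvd n then f n else 0) = (\<Sum>m=1..N div d. f (d * m))"
proof -
  have "(\<Sum>n=1..N. if d dvd n then f n else 0) = sum f {n\<in>{1..N}. d dvd n}"
    by (rule sum.inter_filter[symmetric]) simp
  also have "\<dots> = (\<Sum>m=1..N div d. f (d * m))"
  proof (rule sum.reindex_bij_witness[of _ "\<lambda>m. d * m" "\<lambda>n. n div d"])
    fix n assume n: "n \<in> {n\<in>{1..N}. d dvd n}"
    then show "d * (n div d) = n" by auto
    show "f (d * (n div d)) = f n" using n by auto
    show "n div d \<in> {1..N div d}" using n assms by (auto simp: div_le_mono Suc_le_eq div_greater_zero_iff intro: dvd_imp_le)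
  next
    fix m assume m: "m \<in> {1..N div d}"
    then show "d * m div d = m" using assms by simp
    show "d * m \<in> {n \<in> {1..N}. d dvd n}"
      using m assms by (auto simp: Suc_le_eq less_eq_div_iff_mult_less_eq mult.commute)
  qed
  finally show ?thesis .
qed

lemma count_multiples:
  assumes "d > 0"
  shows "(\<Sum>n=1..N. of_bool (d dvd n)) = real (N div d)"
  using sum_over_multiples[OF assms, where N = N and f = "\<lambda>_. 1 :: real"] by (simp add: of_bool_def)

text \<open>Erdos's argument. If the primes from $K$ on had reciprocal sum below $1/2$, at most half of the numbers up
  to $N = m^2$ would have such a prime factor, while at most $2^K m$ have none; $m = 2^{K+2}$ makes the
  latter a quarter of $N$.\<close>

theorem prime_reciprocals_not_summable:
  "\<not> summable (\<lambda>p :: nat. if prime p then 1 / real p else 0)" (is "\<not> summable ?R")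
proof
  assume "summable ?R"
  then obtain K where K: "\<And>m n. m \<ge> K \<Longrightarrow> norm (sum ?R {m..<n}) < 1/2"
    unfolding summable_Cauchy by (metis half_gt_zero_iff zero_less_one)
  \<comment> \<open>then $2^K m = m^2/4$\<close>
  define m :: nat where "m = 2 ^ (K + 2)"
  define N where "N = m\<^sup>2"
  define A where "A p = {n\<in>{1..N}. p dvd n}" for p
  define B where "B = {n\<in>{1..N}. \<forall>p. prime p \<longrightarrow> p dvd n \<longrightarrow> p < K}"
  define P where "P = {p. prime p \<and> K \<le> p \<and> p < Suc N}"
  have "finite P" unfolding P_def by simp
  have cA: "real (card (A p)) \<le> real N * ?R p" if "p \<in> P" for p
  proof -
    have p: "prime p" "p > 0" using that by (auto simp: P_def prime_gt_0_nat)
    have "card (A p) = N div p"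
      using count_multiples[OF p(2), of N] by (simp add: A_def of_bool_def sum.If_cases Int_def)
    then show ?thesis using p of_nat_div_le_of_nat[of N p, where ?'a = real] by simp
  qed
  have "{1..N} \<subseteq> (\<Union>p\<in>P. A p) \<union> B"
  proof
    fix n assume n: "n \<in> {1..N}"
    show "n \<in> (\<Union>p\<in>P. A p) \<union> B"
    proof (cases "n \<in> B")
      case False
      then obtain p where "prime p" "p dvd n" "K \<le> p" using n by (auto simp: B_def)
      moreover have "p \<le> N" using dvd_imp_le[OF \<open>p dvd n\<close>] n by simp
      ultimately show ?thesis using n by (auto simp: P_def A_def)
    qed simp
  qed
  then have "N \<le> card ((\<Union>p\<in>P. A p) \<union> B)"
    using card_mono[of "(\<Union>p\<in>P. A p) \<union> B" "{1..N}"] \<open>finite P\<close> by (simp add: A_def B_def)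
  also have "\<dots> \<le> (\<Sum>p\<in>P. card (A p)) + card B"
    by (rule order_trans[OF card_Un_le add_right_mono[OF card_UN_le[OF \<open>finite P\<close>]]])
  finally have "real N \<le> (\<Sum>p\<in>P. real (card (A p))) + real (card B)"
    by (simp flip: of_nat_sum of_nat_add)
  also have "(\<Sum>p\<in>P. real (card (A p))) \<le> (\<Sum>p\<in>P. real N * ?R p)" by (rule sum_mono[OF cA])
  also have "\<dots> = real N * sum ?R {K..<Suc N}"
  proof -
    have "sum ?R P = sum ?R {K..<Suc N}"
      by (rule sum.mono_neutral_left) (auto simp: P_def)
    then show ?thesis by (simp only: sum_distrib_left[symmetric])
  qed
  also have "\<dots> \<le> real N * (1/2)" using K[of K "Suc N"] by (intro mult_left_mono) auto
  also have "real (card B) \<le> real (2 ^ K * m)"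
    using card_small_prime_factors_le[of m K] unfolding B_def N_def by (simp only: of_nat_le_iff)
  also have "\<dots> = real N / 4" by (simp add: N_def m_def power2_eq_square power_add)
  finally have "real N \<le> 3/4 * real N" by simp
  moreover have "real N > 0" by (simp add: N_def m_def)
  ultimately show False by simp
qed

lemma prime_reciprocals_between_powers_of_two:
  obtains j1 where "j0 \<le> j1" "(\<Sum>p | prime p \<and> 2 ^ j0 \<le> p \<and> p < 2 ^ j1. 1 / real p) \<ge> A"
proof -
  define R where "R p = (if prime p then 1 / real p else 0)" for p :: nat
  have "\<exists>n. sum R {..<n} > A + sum R {..<2 ^ j0}"
  proof (rule ccontr)
    assume "\<not> ?thesis"
    then have "summable R"
      by (intro summableI_nonneg_bounded[of _ "A + sum R {..<2 ^ j0}"]) (auto simp: R_def not_less)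
    then show False using prime_reciprocals_not_summable by (simp add: R_def[abs_def])
  qed
  then obtain n where n: "sum R {..<n} > A + sum R {..<2 ^ j0}" ..
  define j1 where "j1 = max j0 n"
  have "n \<le> 2 ^ n" using less_exp[of n] by simp
  also have "(2::nat) ^ n \<le> 2 ^ j1" by (rule power_increasing) (auto simp: j1_def)
  finally have "n \<le> 2 ^ j1" .
  then have "sum R {..<n} \<le> sum R {..<2 ^ j1}" by (intro sum_mono2) (auto simp: R_def)
  moreover have "(2::nat) ^ j0 \<le> 2 ^ j1" by (simp add: j1_def)
  then have "sum R {..<2 ^ j1} = sum R {..<2 ^ j0} + sum R {2 ^ j0..<2 ^ j1}"
    by (metis lessThan_atLeast0 sum.atLeastLessThan_concat zero_le)
  moreover have "sum R {2 ^ j0..<2 ^ j1} = (\<Sum>p | prime p \<and> 2 ^ j0 \<le> p \<and> p < 2 ^ j1. 1 / real p)"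
    by (rule sum.mono_neutral_cong_right) (auto simp: R_def)
  ultimately show ?thesis using n by (intro that[of j1]) (auto simp: j1_def)
qed

section \<open>Orthogonality to bounded multiplicative functions\<close>

text \<open>Expanding the square, the events $p \mid n$ for different primes of $P$ are uncorrelated up to rounding,
  so that only the diagonal contributes to the variance.\<close>

lemma turan_kubilius_finite:
  fixes P :: "nat set"
  assumes P: "finite P" "\<And>p. p \<in> P \<Longrightarrow> prime p"
  defines "A \<equiv> \<Sum>p\<in>P. 1 / real p"
  shows "(\<Sum>n=1..N. ((\<Sum>p\<in>P. of_bool (p dvd n)) - A)\<^sup>2) \<le> real N * A + 2 * A * real (card P)"
proof -
  define \<omega> where "\<omega> n = (\<Sum>p\<in>P. of_bool (p dvd n) :: real)" for n
  have pos: "p > 0" if "p \<in> P" for p using P(2)[OF that] by (rule prime_gt_0_nat)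
  have A0: "A \<ge> 0" unfolding A_def by (intro sum_nonneg) auto
  have pair: "(\<Sum>n=1..N. of_bool (p dvd n) * of_bool (q dvd n)) \<le> real N / (real p * real q) + (if p = q then real N / real p else 0)"
    if pq: "p \<in> P" "q \<in> P" for p q
  proof (cases "p = q")
    case True
    have "(\<Sum>n=1..N. of_bool (p dvd n) * of_bool (q dvd n)) = real (N div p)"
      using count_multiples[OF pos[OF pq(1)], of N] by (simp add: True flip: of_bool_conj)
    also have "\<dots> \<le> real N / real p" by (rule of_nat_div_le_of_nat)
    finally show ?thesis using True by (simp add: add_increasing)
  next
    case False
    have "coprime p q" using P(2)[OF pq(1)] P(2)[OF pq(2)] False by (simp add: primes_coprime)
    then have "p dvd n \<and> q dvd n \<longleftrightarrow> p * q dvd n" for n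
      by (auto intro: divides_mult dvd_mult_left dvd_mult_right)
    then have "(\<Sum>n=1..N. of_bool (p dvd n) * of_bool (q dvd n)) = (\<Sum>n=1..N. of_bool (p * q dvd n) :: real)"
      by (simp flip: of_bool_conj)
    also have "\<dots> = real (N div (p * q))" using pos pq by (intro count_multiples) simp
    also have "\<dots> \<le> real N / (real p * real q)" using of_nat_div_le_of_nat[of N "p * q", where ?'a = real] by simp
    finally show ?thesis using False by simp
  qed
  have "(\<Sum>n=1..N. (\<omega> n)\<^sup>2) = (\<Sum>n=1..N. \<Sum>p\<in>P. \<Sum>q\<in>P. of_bool (p dvd n) * of_bool (q dvd n))"
    by (simp add: \<omega>_def power2_eq_square sum_product)
  also have "\<dots> = (\<Sum>p\<in>P. \<Sum>q\<in>P. \<Sum>n=1..N. of_bool (p dvd n) * of_bool (q dvd n))"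
    by (subst sum.swap, intro sum.cong refl sum.swap)
  also have "\<dots> \<le> (\<Sum>p\<in>P. \<Sum>q\<in>P. real N / (real p * real q) + (if p = q then real N / real p else 0))"
    by (intro sum_mono pair)
  also have "\<dots> = (\<Sum>p\<in>P. \<Sum>q\<in>P. real N * ((1 / real p) * (1 / real q))) + (\<Sum>p\<in>P. real N / real p)"
    using P(1) by (simp add: sum.distrib)
  also have "(\<Sum>p\<in>P. \<Sum>q\<in>P. real N * ((1 / real p) * (1 / real q))) = real N * A\<^sup>2"
    unfolding A_def power2_eq_square sum_product by (simp only: sum_distrib_left)
  also have "(\<Sum>p\<in>P. real N / real p) = real N * A"
    unfolding A_def by (simp add: sum_distrib_left)
  finally have second: "(\<Sum>n=1..N. (\<omega> n)\<^sup>2) \<le> real N * A\<^sup>2 + real N * A" .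
  have "real N * A - real (card P) = (\<Sum>p\<in>P. real N / real p - 1)"
    unfolding A_def by (simp add: sum_distrib_left sum_subtractf)
  also have "\<dots> \<le> (\<Sum>p\<in>P. real (N div p))"
  proof (rule sum_mono)
    fix p assume "p \<in> P"
    then have "real (N mod p) / real p \<le> 1" using pos by (simp add: mod_less_divisor less_imp_le)
    then show "real N / real p - 1 \<le> real (N div p)"
      using of_nat_of_nat_div_aux[of N p, where ?'a = real] by simp
  qed
  also have "\<dots> = (\<Sum>p\<in>P. \<Sum>n=1..N. of_bool (p dvd n))"
    by (intro sum.cong refl count_multiples[symmetric] pos)
  also have "\<dots> = (\<Sum>n=1..N. \<omega> n)" unfolding \<omega>_def by (rule sum.swap)
  finally have "2 * A * (real N * A - real (card P)) \<le> 2 * A * (\<Sum>n=1..N. \<omega> n)"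
    using A0 by (intro mult_left_mono) auto
  moreover have "(\<Sum>n=1..N. (\<omega> n - A)\<^sup>2) = (\<Sum>n=1..N. (\<omega> n)\<^sup>2) - 2 * A * (\<Sum>n=1..N. \<omega> n) + real N * A\<^sup>2"
    by (simp add: power2_diff sum.distrib sum_subtractf sum_distrib_left algebra_simps)
  ultimately show ?thesis using second unfolding \<omega>_def by (simp add: power2_eq_square algebra_simps)
qed

lemma sum_abs_omega_minus_mean_le:
  fixes P :: "nat set"
  assumes P: "finite P" "\<And>p. p \<in> P \<Longrightarrow> prime p" and N: "card P \<le> N"
  defines "A \<equiv> \<Sum>p\<in>P. 1 / real p"
  shows "(\<Sum>n=1..N. \<bar>(\<Sum>p\<in>P. of_bool (p dvd n)) - A\<bar>) \<le> real N * sqrt (3 * A)"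
proof -
  define w where "w n = \<bar>(\<Sum>p\<in>P. of_bool (p dvd n)) - A\<bar>" for n
  have A0: "A \<ge> 0" unfolding A_def by (intro sum_nonneg) auto
  have "(\<Sum>n=1..N. w n)\<^sup>2 \<le> (\<Sum>n=1..N. (w n)\<^sup>2) * real N"
    using Cauchy_Schwarz_ineq_sum[of w "\<lambda>_. 1" "{1..N}"] by simp
  also have "\<dots> \<le> (real N * A + 2 * A * real (card P)) * real N"
    using turan_kubilius_finite[OF P, of N] unfolding w_def A_def by (intro mult_right_mono) auto
  also have "\<dots> \<le> (real N * A + 2 * A * real N) * real N"
    using N A0 by (intro mult_right_mono add_left_mono mult_left_mono) auto
  also have "\<dots> = (real N * sqrt (3 * A))\<^sup>2" using A0 by (simp add: power_mult_distrib power2_eq_square)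
  finally show ?thesis unfolding w_def by (rule power2_le_imp_le) (use A0 in auto)
qed

text \<open>Exchange the two sums, drop $u(m)$ by the Cauchy-Schwarz inequality, and expand the square: the diagonal
  $p = q$ is bounded trivially, the other terms by the correlation hypothesis. Only primes of comparable
  size should be treated together, because a pair $p, q$ contributes a sum of length $N / \max(p,q)$,
  which is bounded here by $N/Q$.\<close>

lemma block_bilinear_bound:
  fixes a u :: "nat \<Rightarrow> complex" and Q :: nat
  assumes Q: "Q > 0" and P: "finite P" "\<And>p. p \<in> P \<Longrightarrow> Q \<le> p"
    and a: "\<And>n. norm (a n) \<le> 1" and u: "\<And>n. n > 0 \<Longrightarrow> norm (u n) \<le> 1"
    and corr: "\<And>p q n. p \<in> P \<Longrightarrow> q \<in> P \<Longrightarrow> p \<noteq> q \<Longrightarrow>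
                 norm (\<Sum>m=1..n. a (p * m) * cnj (a (q * m))) \<le> \<epsilon> * real n + C"
    and "\<epsilon> \<ge> 0" "C \<ge> 0"
  shows "norm (\<Sum>p\<in>P. \<Sum>m=1..N div p. a (p * m) * (u p * u m))
     \<le> sqrt (real N / Q * (real (card P) * (real N / Q) + (real (card P))\<^sup>2 * (\<epsilon> * (real N / Q) + C)))"
proof -
  define K where "K = N div Q"
  have KNQ: "real K \<le> real N / Q" unfolding K_def by (rule of_nat_div_le_of_nat)
  have KN: "N div p \<le> K" if "p \<in> P" for p
    unfolding K_def using P(2)[OF that] Q by (intro div_le_mono2)
  have NQ: "real (N div p) \<le> real N / Q" if "p \<in> P" for p using KN[OF that] KNQ by linarith
  define G where "G m = (\<Sum>p\<in>P. if m \<le> N div p then u p * a (p * m) else 0)" for m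
  have ind: "(\<Sum>m=1..K. if m \<le> L then f m else 0) = (\<Sum>m=1..L. f m)" if "L \<le> K" for L and f :: "nat \<Rightarrow> complex"
    using that by (intro sum.mono_neutral_cong_right) auto
  have "(\<Sum>p\<in>P. \<Sum>m=1..N div p. a (p * m) * (u p * u m))
      = (\<Sum>p\<in>P. \<Sum>m=1..K. if m \<le> N div p then a (p * m) * (u p * u m) else 0)"
    by (intro sum.cong refl ind[symmetric] KN)
  also have "\<dots> = (\<Sum>m=1..K. u m * G m)"
    unfolding G_def sum_distrib_left by (subst sum.swap) (auto intro!: sum.cong)
  also have "norm \<dots> \<le> (\<Sum>m=1..K. norm (G m))"
  proof (rule sum_norm_le)
    fix m assume "m \<in> {1..K}"
    then have "norm (u m) \<le> 1" using u by simp
    then show "norm (u m * G m) \<le> norm (G m)" by (simp add: norm_mult mult_left_le_one_le)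
  qed
  also have "\<dots> \<le> sqrt (real K * (\<Sum>m=1..K. (norm (G m))\<^sup>2))"
    using Cauchy_Schwarz_ineq_sum[of "\<lambda>m. norm (G m)" "\<lambda>_. 1" "{1..K}"]
    by (intro real_le_rsqrt) (simp add: mult.commute)
  also have "\<dots> \<le> sqrt (real N / Q * (real (card P) * (real N / Q) + (real (card P))\<^sup>2 * (\<epsilon> * (real N / Q) + C)))"
  proof -
    have pair: "norm (\<Sum>m=1..K. (if m \<le> N div p then u p * a (p * m) else 0) * cnj (if m \<le> N div q then u q * a (q * m) else 0))
        \<le> (if p = q then real N / Q else 0) + (\<epsilon> * (real N / Q) + C)"
      if pq: "p \<in> P" "q \<in> P" for p q
    proof -
      define L where "L = min (N div p) (N div q)"
      have LK: "L \<le> K" using KN[OF pq(1)] by (simp add: L_def)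
      have LNQ: "real L \<le> real N / Q" using LK KNQ by linarith
      have up: "norm (u p) \<le> 1" "norm (u q) \<le> 1" using u P(2) Q pq by (meson less_le_trans)+
      have "(\<Sum>m=1..K. (if m \<le> N div p then u p * a (p * m) else 0) * cnj (if m \<le> N div q then u q * a (q * m) else 0))
          = (\<Sum>m=1..K. if m \<le> L then (u p * cnj (u q)) * (a (p * m) * cnj (a (q * m))) else 0)"
        by (intro sum.cong refl) (auto simp: L_def)
      also have "\<dots> = (u p * cnj (u q)) * (\<Sum>m=1..L. a (p * m) * cnj (a (q * m)))"
        unfolding ind[OF LK] sum_distrib_left ..
      also have "norm \<dots> \<le> norm (\<Sum>m=1..L. a (p * m) * cnj (a (q * m)))"
        using up by (simp add: norm_mult mult_left_le_one_le mult_le_one)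
      also have "\<dots> \<le> (if p = q then real N / Q else 0) + (\<epsilon> * (real N / Q) + C)"
      proof (cases "p = q")
        case True
        have "norm (\<Sum>m=1..L. a (p * m) * cnj (a (q * m))) \<le> real L"
          using sum_norm_bound[of "{1..L}" "\<lambda>m. a (p * m) * cnj (a (q * m))" 1] a
          by (simp add: norm_mult mult_le_one)
        moreover have "0 \<le> \<epsilon> * (real N / Q) + C" using \<open>\<epsilon> \<ge> 0\<close> \<open>C \<ge> 0\<close> by simp
        ultimately show ?thesis using LNQ True by simp
      next
        case False
        have "\<epsilon> * real L \<le> \<epsilon> * (real N / Q)" using LNQ \<open>\<epsilon> \<ge> 0\<close> by (rule mult_left_mono)
        then show ?thesis using corr[OF pq False, of L] False by simp
      qed
      finally show ?thesis .
    qed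
    have "complex_of_real (\<Sum>m=1..K. (norm (G m))\<^sup>2) = (\<Sum>m=1..K. G m * cnj (G m))"
      by (simp only: of_real_sum complex_norm_square)
    also have "\<dots> = (\<Sum>m=1..K. \<Sum>p\<in>P. \<Sum>q\<in>P. (if m \<le> N div p then u p * a (p * m) else 0) * cnj (if m \<le> N div q then u q * a (q * m) else 0))"
      unfolding G_def cnj_sum sum_product ..
    also have "\<dots> = (\<Sum>p\<in>P. \<Sum>q\<in>P. \<Sum>m=1..K. (if m \<le> N div p then u p * a (p * m) else 0) * cnj (if m \<le> N div q then u q * a (q * m) else 0))"
      by (subst sum.swap, intro sum.cong refl sum.swap)
    finally have "norm (complex_of_real (\<Sum>m=1..K. (norm (G m))\<^sup>2))
        = norm (\<Sum>p\<in>P. \<Sum>q\<in>P. \<Sum>m=1..K. (if m \<le> N div p then u p * a (p * m) else 0) * cnj (if m \<le> N div q then u q * a (q * m) else 0))"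
      by simp
    also have "\<dots> \<le> (\<Sum>p\<in>P. \<Sum>q\<in>P. (if p = q then real N / Q else 0) + (\<epsilon> * (real N / Q) + C))"
      by (intro sum_norm_le pair)
    also have "\<dots> = real (card P) * (real N / Q) + (real (card P))\<^sup>2 * (\<epsilon> * (real N / Q) + C)"
      using P(1) by (simp add: sum.distrib power2_eq_square algebra_simps)
    finally have "(\<Sum>m=1..K. (norm (G m))\<^sup>2) \<le> real (card P) * (real N / Q) + (real (card P))\<^sup>2 * (\<epsilon> * (real N / Q) + C)"
      by (simp only: norm_of_real)
    then show ?thesis
      using KNQ by (intro real_sqrt_le_mono mult_mono) (auto intro: sum_nonneg)
  qed
  finally show ?thesis .
qed

text \<open>Multiplicativity gives $u(pm) = u(p)u(m)$ unless $p \mid m$, which happens for at most $N/p^2$ of the $m$.\<close>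

lemma multiplicative_prime_multiples:
  fixes a u :: "nat \<Rightarrow> complex"
  assumes p: "prime p" and a: "\<And>n. norm (a n) \<le> 1" and u: "\<And>n. n > 0 \<Longrightarrow> norm (u n) \<le> 1"
    and mult: "multiplicative u"
  shows "norm ((\<Sum>m=1..N div p. a (p * m) * u (p * m)) - (\<Sum>m=1..N div p. a (p * m) * (u p * u m)))
     \<le> 2 * real N / (real p)\<^sup>2"
proof -
  have p0: "p > 0" using p by (rule prime_gt_0_nat)
  have "(\<Sum>m=1..N div p. a (p * m) * u (p * m)) - (\<Sum>m=1..N div p. a (p * m) * (u p * u m))
      = (\<Sum>m=1..N div p. a (p * m) * (u (p * m) - u p * u m))"
    by (simp add: sum_subtractf right_diff_distrib)
  also have "norm \<dots> \<le> (\<Sum>m=1..N div p. 2 * of_bool (p dvd m))"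
  proof (rule sum_norm_le)
    fix m assume m: "m \<in> {1..N div p}"
    show "norm (a (p * m) * (u (p * m) - u p * u m)) \<le> 2 * of_bool (p dvd m)"
    proof (cases "p dvd m")
      case False
      then have "coprime p m" using p by (simp add: prime_imp_coprime)
      then have "u (p * m) = u p * u m" using mult p0 m by (auto simp: multiplicative_def)
      then show ?thesis by simp
    next
      case True
      have "norm (u (p * m) - u p * u m) \<le> norm (u (p * m)) + norm (u p) * norm (u m)"
        by (metis norm_triangle_ineq4 norm_mult)
      also have "\<dots> \<le> 1 + 1 * 1" using p0 m by (intro add_mono mult_mono u) auto
      finally have "norm (a (p * m)) * norm (u (p * m) - u p * u m) \<le> 1 * 2"
        using a by (intro mult_mono) auto
      then show ?thesis using True by (simp add: norm_mult)
    qed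
  qed
  also have "\<dots> = 2 * real (N div p div p)"
    unfolding sum_distrib_left[symmetric] count_multiples[OF p0] ..
  also have "\<dots> \<le> 2 * real N / (real p)\<^sup>2"
    using of_nat_div_le_of_nat[of N "p * p", where ?'a = real] by (simp add: div_mult2_eq power2_eq_square)
  finally show ?thesis .
qed

text \<open>With $c \<le> Q$ primes in the block and $X = N/Q$, the bilinear bound is $X(\sqrt c + c\sqrt{2\<epsilon>})$. The
  diagonal part is at most $N/\sqrt Q$, summable over the blocks, and in the other part $c/Q$ is at most
  twice the sum of the reciprocals of the primes in the block.\<close>

lemma dyadic_block_bound:
  fixes a u :: "nat \<Rightarrow> complex" and j :: nat
  defines "P \<equiv> {p :: nat. prime p \<and> 2 ^ j \<le> p \<and> p < 2 ^ Suc j}"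
  assumes a: "\<And>n. norm (a n) \<le> 1" and u: "\<And>n. n > 0 \<Longrightarrow> norm (u n) \<le> 1"
    and mult: "multiplicative u"
    and corr: "\<And>p q n. p \<in> P \<Longrightarrow> q \<in> P \<Longrightarrow> p \<noteq> q \<Longrightarrow>
                 norm (\<Sum>m=1..n. a (p * m) * cnj (a (q * m))) \<le> \<epsilon> * real n + C"
    and "\<epsilon> > 0" "C \<ge> 0" and N: "C \<le> \<epsilon> * (real N / 2 ^ j)"
  shows "norm (\<Sum>p\<in>P. \<Sum>m=1..N div p. a (p * m) * u (p * m))
     \<le> real N * ((1 / sqrt 2) ^ j + 2 * (1 / 2) ^ j + 2 * sqrt (2 * \<epsilon>) * (\<Sum>p\<in>P. 1 / real p))"
proof -
  define Q :: nat where "Q = 2 ^ j"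
  define X where "X = real N / Q"
  define c where "c = real (card P)"
  have Q: "Q > 0" by (simp add: Q_def)
  have PQ: "P \<subseteq> {Q..<2 * Q}" by (auto simp: P_def Q_def)
  have fin: "finite P" using PQ by (rule finite_subset) simp
  have cQ: "c \<le> real Q" using card_mono[OF _ PQ] by (simp add: c_def)
  have X0: "X \<ge> 0" "c \<ge> 0" by (simp_all add: X_def c_def)
  have cA: "c / Q \<le> 2 * (\<Sum>p\<in>P. 1 / real p)"
  proof -
    have "c * (1 / (2 * real Q)) = (\<Sum>p\<in>P. 1 / (2 * real Q))" by (simp add: c_def)
    also have "\<dots> \<le> (\<Sum>p\<in>P. 1 / real p)"
    proof (rule sum_mono)
      fix p assume "p \<in> P"
      then have "Q \<le> p" "p \<le> 2 * Q" using PQ by auto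
      then have "0 < real p" "real p \<le> 2 * real Q" using Q by linarith+
      then show "1 / (2 * real Q) \<le> 1 / real p" by (intro divide_left_mono) auto
    qed
    finally show ?thesis by simp
  qed
  have "norm (\<Sum>p\<in>P. \<Sum>m=1..N div p. a (p * m) * (u p * u m)) \<le> sqrt (X * (c * X + c\<^sup>2 * (\<epsilon> * X + C)))"
    unfolding X_def c_def
    by (rule block_bilinear_bound[OF Q fin _ a u corr]) (use PQ \<open>\<epsilon> > 0\<close> \<open>C \<ge> 0\<close> in auto)
  also have "\<dots> \<le> sqrt (X * (c * X + c\<^sup>2 * (\<epsilon> * X + \<epsilon> * X)))"
    using N X0 by (intro real_sqrt_le_mono mult_left_mono add_left_mono) (auto simp: X_def Q_def)
  also have "X * (c * X + c\<^sup>2 * (\<epsilon> * X + \<epsilon> * X)) = X\<^sup>2 * (c + c\<^sup>2 * (2 * \<epsilon>))"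
    by (simp add: power2_eq_square algebra_simps)
  also have "sqrt \<dots> = X * sqrt (c + c\<^sup>2 * (2 * \<epsilon>))" using X0 by (simp add: real_sqrt_mult)
  also have "\<dots> \<le> X * (sqrt c + c * sqrt (2 * \<epsilon>))"
    using sqrt_add_le_add_sqrt[of c "c\<^sup>2 * (2 * \<epsilon>)"] X0 \<open>\<epsilon> > 0\<close>
    by (intro mult_left_mono) (auto simp: real_sqrt_mult)
  also have "\<dots> \<le> real N * ((1 / sqrt 2) ^ j + 2 * sqrt (2 * \<epsilon>) * (\<Sum>p\<in>P. 1 / real p))"
  proof -
    have "sqrt c / Q \<le> sqrt (real Q) / Q" using cQ by (intro divide_right_mono) auto
    also have "\<dots> = 1 / sqrt (real Q)" using Q by (simp add: real_div_sqrt divide_simps flip: power2_eq_square)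
    also have "\<dots> = (1 / sqrt 2) ^ j" by (simp add: Q_def real_sqrt_power power_one_over)
    finally have 1: "sqrt c / Q \<le> (1 / sqrt 2) ^ j" .
    have 2: "c / Q * sqrt (2 * \<epsilon>) \<le> 2 * (\<Sum>p\<in>P. 1 / real p) * sqrt (2 * \<epsilon>)"
      using cA \<open>\<epsilon> > 0\<close> by (intro mult_right_mono) auto
    have "X * (sqrt c + c * sqrt (2 * \<epsilon>)) = real N * (sqrt c / Q + c / Q * sqrt (2 * \<epsilon>))"
      by (simp add: X_def distrib_left mult_ac)
    also have "\<dots> \<le> real N * ((1 / sqrt 2) ^ j + 2 * (\<Sum>p\<in>P. 1 / real p) * sqrt (2 * \<epsilon>))"
      by (rule mult_left_mono[OF add_mono[OF 1 2]]) simp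
    finally show ?thesis by (simp add: mult_ac)
  qed
  finally have main: "norm (\<Sum>p\<in>P. \<Sum>m=1..N div p. a (p * m) * (u p * u m))
    \<le> real N * ((1 / sqrt 2) ^ j + 2 * sqrt (2 * \<epsilon>) * (\<Sum>p\<in>P. 1 / real p))" .
  have "norm ((\<Sum>p\<in>P. \<Sum>m=1..N div p. a (p * m) * u (p * m)) - (\<Sum>p\<in>P. \<Sum>m=1..N div p. a (p * m) * (u p * u m)))
      \<le> (\<Sum>p\<in>P. 2 * real N / (real Q)\<^sup>2)"
  proof (subst sum_subtractf[symmetric], rule sum_norm_le)
    fix p assume p: "p \<in> P"
    then have "prime p" "Q \<le> p" using PQ by (auto simp: P_def)
    have "norm ((\<Sum>m=1..N div p. a (p * m) * u (p * m)) - (\<Sum>m=1..N div p. a (p * m) * (u p * u m)))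
        \<le> 2 * real N / (real p)\<^sup>2"
      by (rule multiplicative_prime_multiples[OF \<open>prime p\<close> a u mult])
    also have "\<dots> \<le> 2 * real N / (real Q)\<^sup>2"
      using \<open>Q \<le> p\<close> Q by (intro divide_left_mono power_mono mult_pos_pos zero_less_power) auto
    finally show "norm ((\<Sum>m=1..N div p. a (p * m) * u (p * m)) - (\<Sum>m=1..N div p. a (p * m) * (u p * u m)))
        \<le> 2 * real N / (real Q)\<^sup>2" .
  qed
  also have "\<dots> = c * (2 * real N / (real Q)\<^sup>2)" by (simp add: c_def)
  also have "\<dots> \<le> real Q * (2 * real N / (real Q)\<^sup>2)" using cQ by (rule mult_right_mono) simp
  also have "\<dots> = real N * (2 * (1 / 2) ^ j)"
    using Q by (simp add: power2_eq_square Q_def power_one_over)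
  finally have "norm ((\<Sum>p\<in>P. \<Sum>m=1..N div p. a (p * m) * u (p * m)) - (\<Sum>p\<in>P. \<Sum>m=1..N div p. a (p * m) * (u p * u m)))
      \<le> real N * (2 * (1 / 2) ^ j)" .
  with main have "norm (\<Sum>p\<in>P. \<Sum>m=1..N div p. a (p * m) * u (p * m))
      \<le> real N * (2 * (1 / 2) ^ j) + real N * ((1 / sqrt 2) ^ j + 2 * sqrt (2 * \<epsilon>) * (\<Sum>p\<in>P. 1 / real p))"
    using norm_triangle_sub[of "\<Sum>p\<in>P. \<Sum>m=1..N div p. a (p * m) * u (p * m)"
        "\<Sum>p\<in>P. \<Sum>m=1..N div p. a (p * m) * (u p * u m)"] by linarith
  then show ?thesis by (simp add: algebra_simps)
qed

lemma sum_dyadic_blocks: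
  fixes g :: "nat \<Rightarrow> 'a::comm_monoid_add"
  assumes "j0 \<le> j1"
  shows "(\<Sum>p | prime p \<and> 2 ^ j0 \<le> p \<and> p < 2 ^ j1. g p)
       = (\<Sum>j\<in>{j0..<j1}. \<Sum>p | prime p \<and> 2 ^ j \<le> p \<and> p < 2 ^ Suc j. g p)"
  using assms
proof (induction j1 rule: dec_induct)
  case base
  then show ?case by (auto intro!: sum.neutral)
next
  case (step j1)
  have le: "(2::nat) ^ j0 \<le> 2 ^ j1" using step by simp
  have "{p. prime p \<and> 2 ^ j0 \<le> p \<and> p < (2::nat) ^ Suc j1}
      = {p. prime p \<and> 2 ^ j0 \<le> p \<and> p < 2 ^ j1} \<union> {p. prime p \<and> 2 ^ j1 \<le> p \<and> p < 2 ^ Suc j1}"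
    using le by (auto intro: order_trans[OF le])
  moreover have "sum g ({p. prime p \<and> 2 ^ j0 \<le> p \<and> p < 2 ^ j1} \<union> {p. prime p \<and> 2 ^ j1 \<le> p \<and> p < 2 ^ Suc j1})
      = sum g {p. prime p \<and> 2 ^ j0 \<le> p \<and> p < 2 ^ j1} + sum g {p. prime p \<and> 2 ^ j1 \<le> p \<and> p < 2 ^ Suc j1}"
    by (rule sum.union_disjoint) auto
  ultimately show ?case using step by simp
qed

lemma geometric_tail_bounds:
  "(\<Sum>j\<in>{j0..<j1}. (1 / sqrt 2) ^ j + 2 * (1 / 2) ^ j) \<le> 8"
proof -
  have "4 / 3 \<le> sqrt 2" by (rule real_le_rsqrt) (simp add: power2_eq_square)
  then have r: "1 / sqrt 2 \<le> 3 / 4" by (simp add: field_simps)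
  have "(\<Sum>j\<in>{j0..<j1}. (1 / sqrt 2) ^ j + 2 * (1 / 2) ^ j) \<le> (\<Sum>j\<in>{j0..<j1}. (3 / 4) ^ j + 2 * (1 / 2) ^ j)"
    using r by (intro sum_mono add_right_mono power_mono) auto
  also have "\<dots> \<le> (\<Sum>j<j1. (3 / 4) ^ j + 2 * (1 / 2) ^ j)" by (intro sum_mono2) auto
  also have "\<dots> = 4 * (1 - (3/4)^j1) + 4 * (1 - (1/2)^j1)"
    by (induction j1) (simp_all add: algebra_simps)
  also have "\<dots> \<le> 8"
  proof -
    have *: "4 * (1 - x) + 4 * (1 - y) \<le> 8" if "0 \<le> x" "0 \<le> y" for x y :: real
      using that by simp
    show ?thesis by (rule *) (rule zero_le_power, simp)+
  qed
  finally show ?thesis .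
qed

text \<open>Replace the constant $A$ by the number $\<omega>(n)$ of primes of $P$ that divide $n$, at the cost of the
  Turan-Kubilius error, and sort $\<Sum>_n a(n)u(n)\<omega>(n)$ by these primes and their dyadic blocks. All
  error terms but the last are $o(A)$ as $A$ grows, whatever the range of the primes.\<close>

lemma weighted_sum_bound:
  fixes a u :: "nat \<Rightarrow> complex"
  defines "P j0 j1 \<equiv> {p. prime p \<and> 2 ^ j0 \<le> p \<and> p < (2::nat) ^ j1}"
  assumes a: "\<And>n. norm (a n) \<le> 1" and u: "\<And>n. n > 0 \<Longrightarrow> norm (u n) \<le> 1"
    and mult: "multiplicative u" and j: "j0 \<le> j1"
    and corr: "\<And>p q. p \<in> P j0 j1 \<Longrightarrow> q \<in> P j0 j1 \<Longrightarrow> p \<noteq> q \<Longrightarrow>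
                 \<exists>C. \<forall>n. norm (\<Sum>m=1..n. a (p * m) * cnj (a (q * m))) \<le> \<epsilon> * real n + C"
    and "\<epsilon> > 0" and A: "A = (\<Sum>p\<in>P j0 j1. 1 / real p)"
  shows "\<exists>N0. \<forall>N\<ge>N0. A * norm (\<Sum>n=1..N. a n * u n)
           \<le> real N * (sqrt (3 * A) + 8 + 2 * sqrt (2 * \<epsilon>) * A)"
proof -
  have fin: "finite (P j0 j1)" unfolding P_def by simp
  obtain C where C: "\<And>p q n. p \<in> P j0 j1 \<Longrightarrow> q \<in> P j0 j1 \<Longrightarrow> p \<noteq> q \<Longrightarrow>
      norm (\<Sum>m=1..n. a (p * m) * cnj (a (q * m))) \<le> \<epsilon> * real n + C p q"
    using corr by metis
  \<comment> \<open>one constant for all pairs of the finitely many primes, negligible for large $N$\<close>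
  define D where "D = (\<Sum>p\<in>P j0 j1. \<Sum>q\<in>P j0 j1. \<bar>C p q\<bar>)"
  have D0: "D \<ge> 0" unfolding D_def by (intro sum_nonneg) auto
  have CD: "C p q \<le> D" if "p \<in> P j0 j1" "q \<in> P j0 j1" for p q
  proof -
    have "\<bar>C p q\<bar> \<le> (\<Sum>q\<in>P j0 j1. \<bar>C p q\<bar>)" by (rule member_le_sum[OF that(2)]) (use fin in auto)
    also have "\<dots> \<le> D" unfolding D_def
      by (rule member_le_sum[OF that(1), of "\<lambda>p. \<Sum>q\<in>P j0 j1. \<bar>C p q\<bar>"]) (use fin in \<open>auto intro: sum_nonneg\<close>)
    finally show ?thesis by simp
  qed
  have A0: "A \<ge> 0" unfolding A by (intro sum_nonneg) auto
  \<comment> \<open>large enough for the Turan-Kubilius bound and for $D \<le> \<epsilon>N/2^{j}$ in all blocks\<close>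
  define N0 where "N0 = max (card (P j0 j1)) (nat \<lceil>2 ^ j1 * D / \<epsilon>\<rceil>)"
  have "A * norm (\<Sum>n=1..N. a n * u n) \<le> real N * (sqrt (3 * A) + 8 + 2 * sqrt (2 * \<epsilon>) * A)" if N: "N \<ge> N0" for N
  proof -
    define \<omega> where "\<omega> n = (\<Sum>p\<in>P j0 j1. of_bool (p dvd n) :: real)" for n
    define W where "W = (\<Sum>n=1..N. a n * u n * of_real (\<omega> n))"
    have au: "norm (a n * u n) \<le> 1" if "n \<in> {1..N}" for n
      using that a[of n] u[of n] by (simp add: norm_mult mult_le_one)
    have "of_real A * (\<Sum>n=1..N. a n * u n) = W - (\<Sum>n=1..N. a n * u n * of_real (\<omega> n - A))"
      unfolding W_def sum_distrib_left sum_subtractf[symmetric] by (intro sum.cong refl) (simp add: algebra_simps)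
    moreover have "norm (\<Sum>n=1..N. a n * u n * of_real (\<omega> n - A)) \<le> (\<Sum>n=1..N. \<bar>\<omega> n - A\<bar>)"
    proof (rule sum_norm_le)
      fix n assume "n \<in> {1..N}"
      then show "norm (a n * u n * of_real (\<omega> n - A)) \<le> \<bar>\<omega> n - A\<bar>"
        using mult_right_mono[OF au, of n "\<bar>\<omega> n - A\<bar>"] by (simp only: norm_mult norm_of_real mult_1)
    qed
    moreover have "(\<Sum>n=1..N. \<bar>\<omega> n - A\<bar>) \<le> real N * sqrt (3 * A)"
      unfolding \<omega>_def A using N by (intro sum_abs_omega_minus_mean_le) (auto simp: fin N0_def P_def)
    ultimately have "norm (of_real A * (\<Sum>n=1..N. a n * u n)) \<le> norm W + real N * sqrt (3 * A)"
      using norm_triangle_ineq4[of W "\<Sum>n=1..N. a n * u n * of_real (\<omega> n - A)"] by simp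
    then have 1: "A * norm (\<Sum>n=1..N. a n * u n) \<le> norm W + real N * sqrt (3 * A)"
      using A0 by (simp add: norm_mult)
    have "W = (\<Sum>n=1..N. \<Sum>p\<in>P j0 j1. if p dvd n then a n * u n else 0)"
      unfolding W_def \<omega>_def of_real_sum sum_distrib_left by (intro sum.cong refl) simp
    also have "\<dots> = (\<Sum>p\<in>P j0 j1. \<Sum>n=1..N. if p dvd n then a n * u n else 0)" by (rule sum.swap)
    also have "\<dots> = (\<Sum>p\<in>P j0 j1. \<Sum>m=1..N div p. a (p * m) * u (p * m))"
      by (intro sum.cong refl sum_over_multiples) (auto simp: P_def prime_gt_0_nat)
    also have "\<dots> = (\<Sum>j\<in>{j0..<j1}. \<Sum>p\<in>P j (Suc j). \<Sum>m=1..N div p. a (p * m) * u (p * m))"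
      unfolding P_def by (rule sum_dyadic_blocks[OF j])
    also have "norm \<dots> \<le> (\<Sum>j\<in>{j0..<j1}. real N * ((1 / sqrt 2) ^ j + 2 * (1 / 2) ^ j
        + 2 * sqrt (2 * \<epsilon>) * (\<Sum>p\<in>P j (Suc j). 1 / real p)))"
    proof (rule sum_norm_le)
      fix j assume j: "j \<in> {j0..<j1}"
      then have le: "(2::nat) ^ j0 \<le> 2 ^ j" "(2::nat) ^ Suc j \<le> 2 ^ j1"
        by (auto intro!: power_increasing simp del: power_Suc)
      have sub: "P j (Suc j) \<subseteq> P j0 j1"
        by (auto simp: P_def simp del: power_Suc intro: order_trans[OF le(1)] less_le_trans[OF _ le(2)])
      have "real N \<ge> 2 ^ j1 * D / \<epsilon>" using N by (simp add: N0_def)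
      then have "D \<le> \<epsilon> * (real N / 2 ^ j1)" using \<open>\<epsilon> > 0\<close> by (simp add: field_simps)
      also have "\<dots> \<le> \<epsilon> * (real N / 2 ^ j)"
        using j \<open>\<epsilon> > 0\<close> by (intro mult_left_mono divide_left_mono power_increasing) auto
      finally have D: "D \<le> \<epsilon> * (real N / 2 ^ j)" .
      show "norm (\<Sum>p\<in>P j (Suc j). \<Sum>m=1..N div p. a (p * m) * u (p * m)) \<le> real N * ((1 / sqrt 2) ^ j + 2 * (1 / 2) ^ j
        + 2 * sqrt (2 * \<epsilon>) * (\<Sum>p\<in>P j (Suc j). 1 / real p))"
        unfolding P_def
      proof (rule dyadic_block_bound[OF a u mult _ \<open>\<epsilon> > 0\<close> D0 D], fold P_def)
        fix p q n assume pq: "p \<in> P j (Suc j)" "q \<in> P j (Suc j)" "p \<noteq> q"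
        then have "p \<in> P j0 j1" "q \<in> P j0 j1" using sub by auto
        then show "norm (\<Sum>m=1..n. a (p * m) * cnj (a (q * m))) \<le> \<epsilon> * real n + D"
          using C[of p q n] CD[of p q] pq(3) by linarith
      qed
    qed
    also have "\<dots> = real N * ((\<Sum>j\<in>{j0..<j1}. (1 / sqrt 2) ^ j + 2 * (1 / 2) ^ j) + 2 * sqrt (2 * \<epsilon>) * A)"
      unfolding A P_def sum_dyadic_blocks[OF j]
      by (simp only: sum.distrib sum_distrib_left[symmetric])
    also have "\<dots> \<le> real N * (8 + 2 * sqrt (2 * \<epsilon>) * A)"
      by (intro mult_left_mono add_right_mono geometric_tail_bounds) auto
    finally show ?thesis using 1 by (simp add: algebra_simps)
  qed
  then show ?thesis by blast
qed

text \<open>For a given $\<delta>$, fix $\<epsilon>$ with $2\sqrt{2\<epsilon>} = \<delta>/4$, then take primes beyond the threshold that belongs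
  to $\<epsilon>$ with reciprocal sum $A$ so large that $8$ and $\sqrt{3A}$ are both at most $A\<delta>/4$.\<close>

lemma katai_bourgain_sarnak_ziegler_unit:
  fixes a u :: "nat \<Rightarrow> complex"
  assumes a: "\<And>n. norm (a n) \<le> 1" and u: "\<And>n. n > 0 \<Longrightarrow> norm (u n) \<le> 1"
    and mult: "multiplicative u"
    and corr: "\<And>\<epsilon>. \<epsilon> > 0 \<Longrightarrow> \<exists>P. \<forall>p q. prime p \<and> prime q \<and> p \<noteq> q \<and> p \<ge> P \<and> q \<ge> P \<longrightarrow>
                 (\<exists>C. \<forall>n. norm (\<Sum>m=1..n. a (p * m) * cnj (a (q * m))) \<le> \<epsilon> * real n + C)"
  shows "(\<lambda>N. (\<Sum>n=1..N. a n * u n) / of_nat N) \<longlonglongrightarrow> 0"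
proof (rule LIMSEQ_I)
  fix \<delta> :: real assume "\<delta> > 0"
  define \<epsilon> where "\<epsilon> = \<delta>\<^sup>2 / 128"
  have "\<epsilon> > 0" using \<open>\<delta> > 0\<close> by (simp add: \<epsilon>_def)
  have s\<epsilon>: "2 * sqrt (2 * \<epsilon>) = \<delta> / 4"
  proof -
    have "2 * \<epsilon> = (\<delta> / 8)\<^sup>2" by (simp add: \<epsilon>_def power2_eq_square)
    then show ?thesis using \<open>\<delta> > 0\<close> by simp
  qed
  obtain P where P: "\<And>p q. \<lbrakk>prime p; prime q; p \<noteq> q; p \<ge> P; q \<ge> P\<rbrakk> \<Longrightarrow>
      \<exists>C. \<forall>n. norm (\<Sum>m=1..n. a (p * m) * cnj (a (q * m))) \<le> \<epsilon> * real n + C"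
    using corr[OF \<open>\<epsilon> > 0\<close>] by blast
  \<comment> \<open>primes from $2^P$ on exceed the threshold $P$, and their blocks start at the exponent $P$\<close>
  obtain j1 where j1: "P \<le> j1" "(\<Sum>p | prime p \<and> 2 ^ P \<le> p \<and> p < 2 ^ j1. 1 / real p) \<ge> 32 / \<delta> + 48 / \<delta>\<^sup>2"
    by (rule prime_reciprocals_between_powers_of_two)
  define A where "A = (\<Sum>p | prime p \<and> 2 ^ P \<le> p \<and> p < (2::nat) ^ j1. 1 / real p)"
  have pos: "32 / \<delta> > 0" "48 / \<delta>\<^sup>2 > 0" using \<open>\<delta> > 0\<close> by auto
  have A: "A \<ge> 32 / \<delta>" "A \<ge> 48 / \<delta>\<^sup>2" "A > 0" using j1(2) pos unfolding A_def by linarith+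
  have "\<exists>N0. \<forall>N\<ge>N0. A * norm (\<Sum>n=1..N. a n * u n)
      \<le> real N * (sqrt (3 * A) + 8 + 2 * sqrt (2 * \<epsilon>) * A)"
  proof (rule weighted_sum_bound[OF a u mult j1(1) _ \<open>\<epsilon> > 0\<close> A_def])
    fix p q :: nat
    assume pq: "p \<in> {p. prime p \<and> 2 ^ P \<le> p \<and> p < 2 ^ j1}"
      "q \<in> {p. prime p \<and> 2 ^ P \<le> p \<and> p < 2 ^ j1}" "p \<noteq> q"
    then have "2 ^ P \<le> p" "2 ^ P \<le> q" by auto
    then have "P \<le> p" "P \<le> q" using less_exp[of P] by linarith+
    then show "\<exists>C. \<forall>n. norm (\<Sum>m=1..n. a (p * m) * cnj (a (q * m))) \<le> \<epsilon> * real n + C"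
      using pq by (intro P) auto
  qed
  then obtain N0 where N0: "\<And>N. N \<ge> N0 \<Longrightarrow> A * norm (\<Sum>n=1..N. a n * u n)
      \<le> real N * (sqrt (3 * A) + 8 + 2 * sqrt (2 * \<epsilon>) * A)"
    by blast
  have "8 \<le> \<delta> / 4 * A" using A(1) \<open>\<delta> > 0\<close> by (simp add: field_simps)
  moreover have "sqrt (3 * A) \<le> \<delta> / 4 * A"
  proof (rule real_le_lsqrt)
    have "48 \<le> \<delta>\<^sup>2 * A" using A(2) \<open>\<delta> > 0\<close> by (simp add: field_simps)
    then have "48 * A \<le> \<delta>\<^sup>2 * A * A" using A(3) by (intro mult_right_mono) auto
    then show "3 * A \<le> (\<delta> / 4 * A)\<^sup>2" by (simp add: power2_eq_square field_simps)
  qed (use A(3) \<open>\<delta> > 0\<close> in auto)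
  ultimately have tot: "sqrt (3 * A) + 8 + 2 * sqrt (2 * \<epsilon>) * A \<le> A * (3 / 4 * \<delta>)"
    unfolding s\<epsilon> by (simp add: algebra_simps)
  have "norm ((\<Sum>n=1..N. a n * u n) / of_nat N - 0) < \<delta>" if N: "N \<ge> max N0 1" for N
  proof -
    have "A * norm (\<Sum>n=1..N. a n * u n) \<le> real N * (A * (3 / 4 * \<delta>))"
      using N by (intro order_trans[OF N0 mult_left_mono[OF tot]]) auto
    then have "A * norm (\<Sum>n=1..N. a n * u n) \<le> A * (real N * (3 / 4 * \<delta>))" by (simp only: mult.left_commute)
    then have "norm (\<Sum>n=1..N. a n * u n) \<le> real N * (3 / 4 * \<delta>)" using A(3) by (simp only: mult_le_cancel_left_pos)
    also have "\<dots> < real N * \<delta>" using N \<open>\<delta> > 0\<close> by simp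
    finally show ?thesis using N by (simp add: norm_divide field_simps)
  qed
  then show "\<exists>N0. \<forall>N\<ge>N0. norm ((\<Sum>n=1..N. a n * u n) / of_nat N - 0) < \<delta>" by blast
qed

text \<open>The criterion asks for small correlations of the pairs of large primes only, with a smallness that
  improves with the threshold, not for correlations that vanish for each pair.\<close>

theorem katai_bourgain_sarnak_ziegler:
  fixes a u :: "nat \<Rightarrow> complex"
  assumes a: "\<And>n. norm (a n) \<le> B" and u: "\<And>n. n > 0 \<Longrightarrow> norm (u n) \<le> 1"
    and mult: "multiplicative u"
    and corr: "\<And>\<epsilon>. \<epsilon> > 0 \<Longrightarrow> \<exists>P. \<forall>p q. prime p \<and> prime q \<and> p \<noteq> q \<and> p \<ge> P \<and> q \<ge> P \<longrightarrow>
                 (\<exists>C. \<forall>n. norm (\<Sum>m=1..n. a (p * m) * cnj (a (q * m))) \<le> \<epsilon> * real n + C)"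
  shows "(\<lambda>N. (\<Sum>n=1..N. a n * u n) / of_nat N) \<longlonglongrightarrow> 0"
proof -
  define b where "b = max B 1"
  have b: "b \<ge> 1" "\<And>n. norm (a n) \<le> b" using a by (auto simp: b_def le_max_iff_disj)
  define a' where "a' n = a n / of_real b" for n
  have "(\<lambda>N. (\<Sum>n=1..N. a' n * u n) / of_nat N) \<longlonglongrightarrow> 0"
  proof (rule katai_bourgain_sarnak_ziegler_unit[OF _ u mult])
    show "norm (a' n) \<le> 1" for n using b by (simp add: a'_def norm_divide)
    fix \<epsilon> :: real assume "\<epsilon> > 0"
    have le: "norm (\<Sum>m=1..n. a' (p * m) * cnj (a' (q * m))) \<le> norm (\<Sum>m=1..n. a (p * m) * cnj (a (q * m)))" for p q n
    proof -
      have "(\<Sum>m=1..n. a' (p * m) * cnj (a' (q * m))) = (\<Sum>m=1..n. a (p * m) * cnj (a (q * m))) / of_real (b\<^sup>2)"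
        unfolding a'_def sum_divide_distrib by (intro sum.cong refl) (simp add: power2_eq_square)
      also have "norm \<dots> = norm (\<Sum>m=1..n. a (p * m) * cnj (a (q * m))) / b\<^sup>2"
        by (simp add: norm_divide norm_power)
      also have "\<dots> \<le> norm (\<Sum>m=1..n. a (p * m) * cnj (a (q * m))) / 1"
        using b by (intro divide_left_mono) auto
      finally show ?thesis by simp
    qed
    show "\<exists>P. \<forall>p q. prime p \<and> prime q \<and> p \<noteq> q \<and> p \<ge> P \<and> q \<ge> P \<longrightarrow>
            (\<exists>C. \<forall>n. norm (\<Sum>m=1..n. a' (p * m) * cnj (a' (q * m))) \<le> \<epsilon> * real n + C)"
      using corr[OF \<open>\<epsilon> > 0\<close>] le by (meson order_trans)
  qed
  then have "(\<lambda>N. of_real b * ((\<Sum>n=1..N. a' n * u n) / of_nat N)) \<longlonglongrightarrow> 0"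
    by (rule tendsto_mult_right_zero)
  moreover have "of_real b * ((\<Sum>n=1..N. a' n * u n) / of_nat N) = (\<Sum>n=1..N. a n * u n) / of_nat N" for N
    using b(1) by (simp add: a'_def sum_divide_distrib[symmetric])
  ultimately show ?thesis by (simp only:)
qed

section \<open>Orthogonality along arithmetic progressions\<close>

lemma sum_residue_classes:
  fixes c :: "nat \<Rightarrow> 'a::comm_monoid_add"
  shows "(\<Sum>m<L * k. c m) = (\<Sum>r<k. \<Sum>l<L. c (l * k + r))"
proof -
  have block: "sum c {l * k..<l * k + k} = (\<Sum>r<k. c (l * k + r))" for l
    by (rule sum.reindex_bij_witness[of _ "\<lambda>r. l * k + r" "\<lambda>m. m - l * k"]) auto
  have "(\<Sum>m<L * k. c m) = (\<Sum>l<L. sum c {l * k..<l * k + k})" by (rule sum.nat_group[symmetric])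
  also have "\<dots> = (\<Sum>l<L. \<Sum>r<k. c (l * k + r))"
    by (simp only: block)
  also have "\<dots> = (\<Sum>r<k. \<Sum>l<L. c (l * k + r))" by (rule sum.swap)
  finally show ?thesis .
qed

text \<open>The sequence to which the criterion is applied: the orbit values, spread over the progression $kn + j$
  and extended by zero.\<close>

definition orbit_on_progression :: "('a \<Rightarrow> 'a) \<Rightarrow> ('a \<Rightarrow> complex) \<Rightarrow> 'a \<Rightarrow> nat \<Rightarrow> nat \<Rightarrow> nat \<Rightarrow> complex" where
  "orbit_on_progression T f x k j m = (if m mod k = j then f ((T ^^ (m div k)) x) else 0)"

text \<open>On the residue class $m = lk + r$ the values of $a(pm)$ either all vanish or are
  $f(T^{pl}y)$ with $y = T^{\lfloor pr/k \rfloor}x$; so the correlation splits into at most $k$ correlations of orbits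
  of $T^p$ and $T^q$, started at different points.\<close>

lemma orbit_on_progression_correlations:
  fixes T :: "'a \<Rightarrow> 'a" and f :: "'a \<Rightarrow> complex"
  defines "a x k j \<equiv> orbit_on_progression T f x k j"
  assumes k: "k > 0" and f: "\<And>x. norm (f x) \<le> B" and "\<epsilon> > 0"
    and corr: "\<And>y z. \<exists>C. \<forall>L. norm (\<Sum>l<L. f ((T ^^ (p * l)) y) * cnj (f ((T ^^ (q * l)) z))) \<le> \<epsilon> / k * real L + C"
  shows "\<exists>C. \<forall>n. norm (\<Sum>m=1..n. a x k j (p * m) * cnj (a x k j (q * m))) \<le> \<epsilon> * real n + C"
proof -
  define c where "c m = a x k j (p * m) * cnj (a x k j (q * m))" for m
  have B0: "0 \<le> B" using f[of undefined] norm_ge_zero order_trans by blast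
  have "norm (a x k j m) \<le> B" for m using f B0 by (simp add: a_def orbit_on_progression_def)
  then have cB: "norm (c m) \<le> B * B" for m
    unfolding c_def norm_mult complex_mod_cnj using B0 by (intro mult_mono) auto
  \<comment> \<open>both factors are non-zero only on the classes $r$ with $pr \<equiv> qr \<equiv> j$ modulo $k$\<close>
  have "\<exists>C. \<forall>L. norm (\<Sum>l<L. c (l * k + r)) \<le> \<epsilon> / k * real L + C" for r
  proof (cases "p * r mod k = j \<and> q * r mod k = j")
    case True
    have "a x k j (s * (l * k + r)) = f ((T ^^ (s * l)) ((T ^^ (s * r div k)) x))"
      if s: "s * r mod k = j" for s l
    proof -
      have "s * (l * k + r) = s * r + (s * l) * k" by (simp add: algebra_simps)
      then have "s * (l * k + r) mod k = j" "s * (l * k + r) div k = s * l + s * r div k"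
        using k s by simp_all
      then show ?thesis by (simp add: a_def orbit_on_progression_def funpow_add)
    qed
    then show ?thesis
      using corr[of "(T ^^ (p * r div k)) x" "(T ^^ (q * r div k)) x"] True by (simp add: c_def)
  next
    case False
    have "c (l * k + r) = 0" for l
    proof -
      have "s * (l * k + r) mod k = s * r mod k" for s
        by (metis add_mult_distrib2 mod_mult_self3 mult.assoc)
      then show ?thesis using False by (auto simp: c_def a_def orbit_on_progression_def)
    qed
    then show ?thesis using \<open>\<epsilon> > 0\<close> by (intro exI[of _ 0]) simp
  qed
  then obtain C where C: "\<And>r L. norm (\<Sum>l<L. c (l * k + r)) \<le> \<epsilon> / k * real L + C r" by metis
  have "norm (\<Sum>m=1..n. c m) \<le> \<epsilon> * real n + ((\<Sum>r<k. C r) + real (k + 1) * (B * B))" for n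
  proof -
    define L where "L = n div k"
    have split: "n = L * k + n mod k" by (simp add: L_def)
    have "(\<Sum>m<L * k. c m) + (\<Sum>m\<in>{L * k..<Suc n}. c m) = (\<Sum>m<Suc n. c m)"
      using split by (simp only: lessThan_atLeast0) (intro sum.atLeastLessThan_concat, auto)
    also have "\<dots> = c 0 + (\<Sum>m=1..n. c m)"
      by (simp only: lessThan_Suc_atMost atMost_atLeast0) (simp add: sum.atLeast_Suc_atMost)
    finally have "(\<Sum>m=1..n. c m) = (\<Sum>m<L * k. c m) + (\<Sum>m\<in>{L * k..<Suc n}. c m) - c 0" by simp
    then have "norm (\<Sum>m=1..n. c m) \<le> norm (\<Sum>m<L * k. c m) + norm (\<Sum>m\<in>{L * k..<Suc n}. c m) + norm (c 0)"
      by (simp only:) (rule order_trans[OF norm_triangle_ineq4 add_right_mono[OF norm_triangle_ineq]])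
    moreover have "norm (\<Sum>m<L * k. c m) \<le> \<epsilon> * real n + (\<Sum>r<k. C r)"
    proof -
      have "norm (\<Sum>m<L * k. c m) \<le> (\<Sum>r<k. \<epsilon> / k * real L + C r)"
        unfolding sum_residue_classes by (rule sum_norm_le[OF C])
      also have "\<dots> = \<epsilon> * real L + (\<Sum>r<k. C r)" using k by (simp add: sum.distrib)
      also have "\<epsilon> * real L \<le> \<epsilon> * real n"
        using \<open>\<epsilon> > 0\<close> by (intro mult_left_mono) (auto simp: L_def)
      finally show ?thesis by simp
    qed
    moreover have "norm (\<Sum>m\<in>{L * k..<Suc n}. c m) \<le> real k * (B * B)"
    proof -
      have "norm (\<Sum>m\<in>{L * k..<Suc n}. c m) \<le> real (card {L * k..<Suc n}) * (B * B)"
        by (rule sum_norm_bound[OF cB])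
      also have "\<dots> \<le> real k * (B * B)"
      proof (rule mult_right_mono)
        have "Suc n - L * k \<le> k" using split mod_less_divisor[OF k, of n] by linarith
        then show "real (card {L * k..<Suc n}) \<le> real k" by (simp only: card_atLeastLessThan of_nat_le_iff)
      qed (use B0 in simp)
      finally show ?thesis .
    qed
    ultimately show ?thesis using cB[of 0] by (simp add: algebra_simps)
  qed
  then show ?thesis unfolding c_def by blast
qed

lemma progression_sum_eq:
  fixes u :: "nat \<Rightarrow> complex" and T :: "'a \<Rightarrow> 'a" and f :: "'a \<Rightarrow> complex" and x :: 'a
  assumes k: "k > 0" "j < k"
  defines "b m \<equiv> (if m = 0 then 0 else orbit_on_progression T f x k j m * u m)"
  shows "(\<Sum>n=1..N. f ((T ^^ n) x) * u (k * n + j))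
       = (\<Sum>m=1..Suc N * k - 1. orbit_on_progression T f x k j m * u m) - b j"
proof -
  \<comment> \<open>$b$ drops $m = 0$, where $u$ is unconstrained\<close>
  have "(\<Sum>m=1..Suc N * k - 1. orbit_on_progression T f x k j m * u m) = (\<Sum>m<Suc N * k. b m)"
    unfolding b_def by (rule sum.mono_neutral_cong_left) (use k in auto)
  also have "\<dots> = (\<Sum>r<k. \<Sum>l<Suc N. b (l * k + r))" by (rule sum_residue_classes)
  also have "\<dots> = (\<Sum>r<k. if r = j then \<Sum>l<Suc N. b (l * k + j) else 0)"
  proof (intro sum.cong refl)
    fix r assume "r \<in> {..<k}"
    then have "b (l * k + r) = 0" if "r \<noteq> j" for l
      using that by (simp add: b_def orbit_on_progression_def)
    then show "(\<Sum>l<Suc N. b (l * k + r)) = (if r = j then \<Sum>l<Suc N. b (l * k + j) else 0)"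
      by (cases "r = j") (auto intro!: sum.neutral)
  qed
  also have "\<dots> = (\<Sum>l<Suc N. b (l * k + j))" using k by simp
  also have "\<dots> = b j + (\<Sum>l=1..N. b (l * k + j))"
    by (simp only: lessThan_Suc_atMost atMost_atLeast0) (simp add: sum.atLeast_Suc_atMost)
  also have "(\<Sum>l=1..N. b (l * k + j)) = (\<Sum>n=1..N. f ((T ^^ n) x) * u (k * n + j))"
    using k by (intro sum.cong refl) (auto simp: b_def orbit_on_progression_def mult.commute)
  finally show ?thesis by simp
qed

text \<open>The sum in question is $\<Sum> a(m)u(m)$ over $m < (N+1)k$, up to the term with $m = j$; the length of
  this sum is at most $2kN$.\<close>

theorem AOP_orthogonal_along_progression:
  fixes T :: "'a::metric_space \<Rightarrow> 'a" and f :: "'a \<Rightarrow> complex"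
  assumes comp: "compact (UNIV :: 'a set)" and T: "continuous_on UNIV T"
    and ue: "uniquely_ergodic T M" and aop: "AOP M T"
    and u: "multiplicative u" "\<And>n. n > 0 \<Longrightarrow> norm (u n) \<le> 1"
    and kj: "k > 0" "j < k" and f: "continuous_on UNIV f" "integral\<^sup>L M f = 0"
  shows "(\<lambda>N. 1 / of_nat N * (\<Sum>n=1..N. f ((T ^^ n) x) * u (k * n + j))) \<longlonglongrightarrow> 0"
proof -
  obtain B where B: "B > 0" "\<And>x. norm (f x) \<le> B" by (rule compact_UNIV_bounded[OF comp f(1)]) (rule that)
  define a where "a = orbit_on_progression T f x k j"
  define s where "s M = (\<Sum>m=1..M. a m * u m) / of_nat M" for M
  have "s \<longlonglongrightarrow> 0"
    unfolding s_def
  proof (rule katai_bourgain_sarnak_ziegler[OF _ u(2,1)])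
    show "norm (a n) \<le> B" for n using B by (simp add: a_def orbit_on_progression_def)
    fix \<epsilon> :: real assume "\<epsilon> > 0"
    then have "\<epsilon> / k > 0" using kj by simp
    then obtain P where P: "\<And>p q y z. prime p \<and> prime q \<and> p \<noteq> q \<and> p \<ge> P \<and> q \<ge> P \<Longrightarrow>
        \<exists>C. \<forall>L. norm (\<Sum>l<L. f ((T ^^ (p * l)) y) * cnj (f ((T ^^ (q * l)) z))) \<le> \<epsilon> / k * real L + C"
      using AOP_orbit_correlations[OF comp T ue aop f] by blast
    show "\<exists>P. \<forall>p q. prime p \<and> prime q \<and> p \<noteq> q \<and> p \<ge> P \<and> q \<ge> P \<longrightarrow>
        (\<exists>C. \<forall>n. norm (\<Sum>m=1..n. a (p * m) * cnj (a (q * m))) \<le> \<epsilon> * real n + C)"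
      unfolding a_def using orbit_on_progression_correlations[OF kj(1) B(2) \<open>\<epsilon> > 0\<close> P] by blast
  qed
  moreover have "filterlim (\<lambda>N. Suc N * k - 1) sequentially sequentially"
  proof (rule filterlim_at_top_mono[OF filterlim_ident])
    show "\<forall>\<^sub>F N in sequentially. N \<le> Suc N * k - 1"
    proof (intro always_eventually allI)
      fix N show "N \<le> Suc N * k - 1" using mult_le_mono2[of 1 k "Suc N"] kj by simp
    qed
  qed
  ultimately have lim: "(\<lambda>N. s (Suc N * k - 1)) \<longlonglongrightarrow> 0" by (rule filterlim_compose)
  define b where "b = (if j = 0 then 0 else a j * u j)"
  have "(\<lambda>N. 2 * real k * norm (s (Suc N * k - 1)) + norm b * inverse (real N)) \<longlonglongrightarrow> 2 * real k * 0 + norm b * 0"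
    by (intro tendsto_intros tendsto_norm_zero lim tendsto_inverse_0_at_top filterlim_real_sequentially)
  then have lim0: "(\<lambda>N. 2 * real k * norm (s (Suc N * k - 1)) + norm b * inverse (real N)) \<longlonglongrightarrow> 0" by simp
  show ?thesis
  proof (rule Lim_null_comparison[OF _ lim0], rule eventually_mono[OF eventually_ge_at_top[of 1]])
    fix N :: nat assume N: "N \<ge> 1"
    define M where "M = Suc N * k - 1"
    have M: "0 < M" "real M \<le> 2 * real k * real N"
    proof -
      have "2 * 1 \<le> Suc N * k" using N kj by (intro mult_le_mono) auto
      then show "0 < M" by (simp add: M_def)
      have "Suc N * k \<le> (2 * N) * k" using N by (intro mult_le_mono1) simp
      then have "M \<le> 2 * k * N" unfolding M_def by (simp only: mult.commute mult.left_commute)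
      then show "real M \<le> 2 * real k * real N" by (metis of_nat_le_iff of_nat_mult of_nat_numeral)
    qed
    have "(\<Sum>m=1..M. a m * u m) = of_nat M * s M" using M(1) by (simp add: s_def)
    then have "(\<Sum>n=1..N. f ((T ^^ n) x) * u (k * n + j)) = of_nat M * s M - b"
      unfolding progression_sum_eq[OF kj] a_def b_def M_def by simp
    then have "norm (\<Sum>n=1..N. f ((T ^^ n) x) * u (k * n + j)) \<le> real M * norm (s M) + norm b"
      using norm_triangle_ineq4[of "of_nat M * s M" b] by (simp add: norm_mult)
    also have "\<dots> \<le> 2 * real k * real N * norm (s M) + norm b"
      using M(2) by (intro add_right_mono mult_right_mono) auto
    finally show "norm (1 / of_nat N * (\<Sum>n=1..N. f ((T ^^ n) x) * u (k * n + j)))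
        \<le> 2 * real k * norm (s (Suc N * k - 1)) + norm b * inverse (real N)"
      using N by (simp add: norm_mult norm_divide M_def field_simps)
  qed
qed

lemma multiplicative_moebius_mu: "multiplicative (\<lambda>n. of_int (moebius_mu n))"
  unfolding multiplicative_def
proof (intro allI impI)
  fix m n :: nat assume mn: "m > 0" "n > 0" "coprime m n"
  have sf: "squarefree (m * n) \<longleftrightarrow> squarefree m \<and> squarefree n"
    using mn(3) squarefree_mult_coprime squarefree_multD by blast
  have "prime_factors (m * n) = prime_factors m \<union> prime_factors n"
    using mn by (simp add: prime_factors_product)
  moreover have "prime_factors m \<inter> prime_factors n = {}"
  proof -
    have False if "p \<in> prime_factors m" "p \<in> prime_factors n" for p
      using that mn(3) by (metis coprime_common_divisor_nat in_prime_factors_imp_dvd in_prime_factors_imp_prime not_prime_1)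
    then show ?thesis by blast
  qed
  ultimately have "card (prime_factors (m * n)) = card (prime_factors m) + card (prime_factors n)"
    by (simp add: card_Un_disjoint)
  then show "of_int (moebius_mu (m * n)) = (of_int (moebius_mu m) * of_int (moebius_mu n) :: complex)"
    by (simp add: moebius_mu_def sf power_add)
qed

text \<open>The Moebius function is multiplicative and bounded by 1, so that both parts are instances of
  \<open>AOP_orthogonal_along_progression\<close>.\<close>

theorem corollary8:
  fixes T :: "'a::metric_space \<Rightarrow> 'a" and M :: "'a measure"
  assumes "compact (UNIV :: 'a set)"
    and "\<exists>T'. homeomorphism UNIV UNIV T T'"
    and "uniquely_ergodic T M"
    and "AOP M T"
  shows "(\<forall>u. multiplicative u \<and> (\<forall>n>0. norm (u n) \<le> 1) \<longrightarrow>
            (\<forall>k\<ge>1. \<forall>j<k. \<forall>f :: 'a \<Rightarrow> complex. \<forall>x.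
               continuous_on UNIV f \<and> integral\<^sup>L M f = 0 \<longrightarrow>
               (\<lambda>N. 1 / of_nat N * (\<Sum>n=1..N. f ((T ^^ n) x) * u (k * n + j))) \<longlonglongrightarrow> 0))
       \<and> (\<forall>k\<ge>1. \<forall>j<k. \<forall>f :: 'a \<Rightarrow> complex. \<forall>x.
               continuous_on UNIV f \<and> integral\<^sup>L M f = 0 \<longrightarrow>
               (\<lambda>N. 1 / of_nat N * (\<Sum>n=1..N. f ((T ^^ n) x) * of_int (moebius_mu (k * n + j)))) \<longlonglongrightarrow> 0)"
proof -
  have T: "continuous_on UNIV T" using assms(2) by (auto simp: homeomorphism_def)
  note orth = AOP_orthogonal_along_progression[OF assms(1) T assms(3,4)]
  have moebius: "norm (of_int (moebius_mu n) :: complex) \<le> 1" for n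
    by (simp add: moebius_mu_def norm_power)
  show ?thesis
  proof (intro conjI allI impI)
    fix u and k j :: nat and x and f :: "'a \<Rightarrow> complex"
    assume "multiplicative u \<and> (\<forall>n>0. norm (u n) \<le> 1)" "1 \<le> k" "j < k"
      "continuous_on UNIV f \<and> integral\<^sup>L M f = 0"
    then show "(\<lambda>N. 1 / of_nat N * (\<Sum>n=1..N. f ((T ^^ n) x) * u (k * n + j))) \<longlonglongrightarrow> 0"
      by (intro orth) auto
  next
    fix k j :: nat and x and f :: "'a \<Rightarrow> complex"
    assume "1 \<le> k" "j < k" "continuous_on UNIV f \<and> integral\<^sup>L M f = 0"
    then show "(\<lambda>N. 1 / of_nat N * (\<Sum>n=1..N. f ((T ^^ n) x) * of_int (moebius_mu (k * n + j)))) \<longlonglongrightarrow> 0"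
      using orth[OF multiplicative_moebius_mu moebius] by auto
  qed
qed

end
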